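(* Let $p$ be a prime. For $n\geq 1$ let $P_n$ be a Sylow $p$-subgroup of the symmetric group $S_{p^n}$, and for $k\geq 0$ let $h_n(k)$ be the number of conjugacy classes of $P_n$ consisting of elements of order $\leq p^k$. Then for all integers $n,k\geq 1$ we have the recurrence relation $$h_{n+1}(k)=\frac{1}{p}\big(h_n(k)^p-h_n(k)\big)+h_n(k)+(p-1)h_n(k-1).$$ In particular, for $h_n(n)$, the total number of conjugacy classes of $P_n$, we have $$h_n(n)=\left[p^{\frac{\gamma+1}{p-1}}|P_n|^\gamma\right]-\delta_p,$$ where $0<\gamma<1$ is a constant depending on $p$, and $\delta_p=1$ if $p=2$, and $\delta_p=0$ otherwise.
   Context: Conjugacy classes are taken in $P_n$ itself (under conjugation by elements of $P_n$). In particular $h_n(0)=1$. Here $|P_n|$ is the order of $P_n$, and $[x]$ denotes the integer part of the real number $x$. *)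

theory Defs
  imports Complex_Main "HOL-Algebra.Group_Action" "HOL-Algebra.Multiplicative_Group" "HOL-Algebra.Sym_Groups" "HOL-Computational_Algebra.Primes"
begin

definition is_sylow_subgroup :: "nat \<Rightarrow> ('a, 'b) monoid_scheme \<Rightarrow> 'a set \<Rightarrow> bool" where
  "is_sylow_subgroup p G H \<longleftrightarrow>
     finite (carrier G) \<and> subgroup H G \<and> card H = p ^ multiplicity p (order G)"

definition conjugacy_classes :: "('a, 'b) monoid_scheme \<Rightarrow> 'a set set" where
  "conjugacy_classes G =
     orbits G (carrier G) (\<lambda>g. \<lambda>x \<in> carrier G. g \<otimes>\<^bsub>G\<^esub> x \<otimes>\<^bsub>G\<^esub> inv\<^bsub>G\<^esub> g)"

definition sylow_family :: "nat \<Rightarrow> (nat \<Rightarrow> (nat \<Rightarrow> nat) set) \<Rightarrow> bool" where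
  "sylow_family p P \<longleftrightarrow> (\<forall>n\<ge>1. is_sylow_subgroup p (sym_group (p ^ n)) (P n))"

text \<open>The subset \<open>P n\<close> viewed as a group in its own right, so that conjugation below is by
  elements of \<open>P n\<close> only.\<close>

definition sylow_group :: "nat \<Rightarrow> (nat \<Rightarrow> (nat \<Rightarrow> nat) set) \<Rightarrow> nat \<Rightarrow> (nat \<Rightarrow> nat) monoid" where
  "sylow_group p P n = (sym_group (p ^ n))\<lparr>carrier := P n\<rparr>"

definition num_classes :: "nat \<Rightarrow> (nat \<Rightarrow> (nat \<Rightarrow> nat) set) \<Rightarrow> nat \<Rightarrow> nat \<Rightarrow> nat" where
  "num_classes p P n k = card {C \<in> conjugacy_classes (sylow_group p P n).
                       \<forall>x\<in>C. group.ord (sylow_group p P n) x \<le> p ^ k}"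

end

theory Submission
  imports Defs "HOL-Number_Theory.Cong"
begin

text \<open>
  A Sylow subgroup \<open>P\<^sub>n\<^sub>+\<^sub>1\<close> of \<open>S(p\<^sup>n\<^sup>+\<^sup>1)\<close> is the wreath product of \<open>P\<^sub>n\<close> with a cyclic group
  of order \<open>p\<close>: the wreath product acts faithfully on \<open>p\<close> copies of \<open>{1..p\<^sup>n}\<close>, its order
  \<open>p |P\<^sub>n|\<^sup>p\<close> is the full power of \<open>p\<close> in \<open>(p\<^sup>n\<^sup>+\<^sup>1)!\<close>, and Sylow subgroups are conjugate
  (\<open>sylow_sym_group_iso_wreath\<close>).

  Rather than describing the conjugacy classes of the wreath product, the proof counts commuting
  pairs.  In a finite group \<open>G\<close> the pairs \<open>(x, y)\<close> with \<open>x y = y x\<close> and \<open>x\<^sup>q = 1\<close> number \<open>|G|\<close>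
  times the classes of elements killed by \<open>q\<close> (\<open>card_commuting_pairs\<close>); in a \<open>p\<close>-group, having
  order at most \<open>p\<^sup>k\<close> is the same as being killed by \<open>p\<^sup>k\<close>.  Let \<open>W\<close> be the wreath product of \<open>G\<close>
  with the cyclic group of order \<open>p\<close>.  Commuting pairs inside the base \<open>G\<^sup>p\<close> are \<open>p\<close>-tuples of
  commuting pairs of \<open>G\<close>.  An element \<open>t\<close> outside the base permutes the coordinates in a single
  cycle, because \<open>p\<close> is prime; so a base element commuting with \<open>t\<close> is determined by its
  coordinate at \<open>0\<close>, which may be any element commuting with the product of the coordinates of
  \<open>t\<close> along the cycle.  That product governs the order of \<open>t\<close> as well, and it is equidistributed
  over \<open>G\<close>.  Adding the contributions gives, for the number \<open>h\<close> of classes killed by \<open>p r\<close> in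
  \<open>G\<close> and the number \<open>h'\<close> of those killed by \<open>r\<close>, the value \<open>(h\<^sup>p + (p - 1) h) / p + (p - 1) h'\<close>
  for \<open>W\<close> (\<open>torsion_class_count_wreath\<close>), which is the recurrence.

  The exponent of \<open>P\<^sub>n\<close> divides \<open>p\<^sup>n\<close>, so the total class numbers satisfy
  \<open>a\<^sub>n\<^sub>+\<^sub>1 = (a\<^sub>n\<^sup>p + (p\<^sup>2 - 1) a\<^sub>n) / p\<close>.  Up to a lower order term this is the recursion
  \<open>x \<mapsto> x\<^sup>p / p\<close>, whose solutions are \<open>x\<^sub>n = exp (ln p / (p - 1) + c p\<^sup>n)\<close>.  With \<open>\<delta> = 1\<close> for \<open>p = 2\<close> and
  \<open>\<delta> = 0\<close> otherwise, \<open>a\<^sub>n + \<delta>\<close> grows at least as fast as this recursion and \<open>a\<^sub>n + \<delta> + 1\<close> more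
  slowly, so some solution stays between the two (\<open>power_recursion_sandwich\<close>), and its
  integer part is \<open>a\<^sub>n + \<delta>\<close>.  As \<open>|P\<^sub>n|\<close> is \<open>p\<close> to the power \<open>(p\<^sup>n - 1) / (p - 1)\<close>, this solution
  is the expression in the theorem after the substitution \<open>c = \<gamma> ln p / (p - 1)\<close>.
\<close>

section \<open>Counting conjugacy classes by commuting pairs\<close>

lemma card_pairs:
  assumes "finite A" "\<And>x. x \<in> A \<Longrightarrow> finite (B x)"
  shows "card {(x, y). x \<in> A \<and> y \<in> B x} = (\<Sum>x\<in>A. card (B x))"
proof -
  have "{(x, y). x \<in> A \<and> y \<in> B x} = Sigma A B" by auto
  then show ?thesis using assms by (simp add: card_SigmaI)
qed

definition commuting_pairs :: "('a, 'b) monoid_scheme \<Rightarrow> nat \<Rightarrow> ('a \<times> 'a) set" where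
  "commuting_pairs G q = {(x, y). x \<in> carrier G \<and> y \<in> carrier G \<and>
     x \<otimes>\<^bsub>G\<^esub> y = y \<otimes>\<^bsub>G\<^esub> x \<and> x [^]\<^bsub>G\<^esub> q = \<one>\<^bsub>G\<^esub>}"

definition torsion_class_count :: "('a, 'b) monoid_scheme \<Rightarrow> nat \<Rightarrow> nat" where
  "torsion_class_count G q =
     card {C \<in> conjugacy_classes G. \<forall>x\<in>C. x [^]\<^bsub>G\<^esub> q = \<one>\<^bsub>G\<^esub>}"

lemma (in group) conj_pow:
  assumes "g \<in> carrier G" "x \<in> carrier G"
  shows "(g \<otimes> x \<otimes> inv g) [^] (n::nat) = g \<otimes> x [^] n \<otimes> inv g"
proof (induction n)
  case (Suc n)
  have "inv g \<otimes> (g \<otimes> (x \<otimes> inv g)) = x \<otimes> inv g"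
    using assms by (simp flip: m_assoc)
  then show ?case using Suc assms by (simp add: m_assoc)
qed (use assms in auto)

lemma (in group) commute_iff_conj_eq:
  assumes "g \<in> carrier G" "x \<in> carrier G"
  shows "g \<otimes> x \<otimes> inv g = x \<longleftrightarrow> x \<otimes> g = g \<otimes> x"
  using assms by (metis inv_solve_right m_closed)

lemma (in group) commutes_pow:
  assumes "s \<in> carrier G" "t \<in> carrier G" "s \<otimes> t = t \<otimes> s"
  shows "s \<otimes> t [^] (n::nat) = t [^] n \<otimes> s"
proof (induction n)
  case (Suc n)
  then show ?case using assms by (metis m_assoc nat_pow_Suc nat_pow_closed)
qed (use assms in auto)

text \<open>By the orbit-stabilizer theorem the centralizers of the elements of one class have \<open>order G\<close>
  elements altogether, and the condition \<open>x [^] q = \<one>\<close> depends only on the class of \<open>x\<close>.\<close>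

theorem (in group) card_commuting_pairs:
  assumes fin: "finite (carrier G)"
  shows "card (commuting_pairs G q) = order G * torsion_class_count G q"
proof -
  let ?\<phi> = "\<lambda>g. \<lambda>x \<in> carrier G. g \<otimes> x \<otimes> inv g"
  interpret conj: group_action G "carrier G" ?\<phi> by (rule action_by_conjugation)
  let ?f = "\<lambda>x. if x [^] q = \<one> then card (stabilizer G ?\<phi> x) else 0"
  have orb_pow: "y [^] q = \<one> \<longleftrightarrow> x [^] q = \<one>"
    if "orb \<in> orbits G (carrier G) ?\<phi>" "x \<in> orb" "y \<in> orb" for orb x y
  proof -
    have *: "x [^] q = \<one> \<longleftrightarrow> z [^] q = \<one>"
      if x: "x \<in> orbit G ?\<phi> z" and z: "z \<in> carrier G" for x z
    proof -
      obtain g where g: "g \<in> carrier G" "x = g \<otimes> z \<otimes> inv g"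
        using x z by (auto simp: orbit_def)
      have "x [^] q = g \<otimes> z [^] q \<otimes> inv g" using g z by (simp add: conj_pow)
      then show ?thesis using g z
        by (metis commute_iff_conj_eq conjugation_is_inj l_one nat_pow_closed one_closed r_one)
    qed
    show ?thesis using that * by (auto simp: orbits_def)
  qed
  have "card (commuting_pairs G q) = (\<Sum>x\<in>{x \<in> carrier G. x [^] q = \<one>}. card (stabilizer G ?\<phi> x))"
  proof -
    have "commuting_pairs G q = (SIGMA x:{x \<in> carrier G. x [^] q = \<one>}. stabilizer G ?\<phi> x)"
      by (auto simp: commuting_pairs_def stabilizer_def commute_iff_conj_eq)
    then show ?thesis using fin
      by (simp add: card_SigmaI stabilizer_def)
  qed
  also have "\<dots> = (\<Sum>x\<in>carrier G. ?f x)"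
    using fin by (simp add: sum.If_cases Int_def)
  also have "\<dots> = (\<Sum>orb\<in>orbits G (carrier G) ?\<phi>. \<Sum>x\<in>orb. ?f x)"
    by (rule conj.disjoint_sum[OF fin, symmetric])
  also have "\<dots> = (\<Sum>orb\<in>orbits G (carrier G) ?\<phi>.
      if \<forall>x\<in>orb. x [^] q = \<one> then order G else 0)"
  proof (rule sum.cong[OF refl])
    fix orb assume orb: "orb \<in> orbits G (carrier G) ?\<phi>"
    show "(\<Sum>x\<in>orb. ?f x) = (if \<forall>x\<in>orb. x [^] q = \<one> then order G else 0)"
    proof (cases "\<forall>x\<in>orb. x [^] q = \<one>")
      case True
      then show ?thesis using conj.card_stablizer_sum[OF fin orb] by simp
    next
      case False
      then have "\<forall>x\<in>orb. x [^] q \<noteq> \<one>" using orb_pow[OF orb] by blast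
      then show ?thesis using False by (auto intro!: sum.neutral)
    qed
  qed
  also have "\<dots> = order G * torsion_class_count G q"
  proof -
    have "finite (orbits G (carrier G) ?\<phi>)"
      using fin by (simp add: orbits_def setcompr_eq_image)
    then show ?thesis
      by (simp add: sum.If_cases torsion_class_count_def conjugacy_classes_def Int_def)
  qed
  finally show ?thesis .
qed

lemma (in group) Union_conjugacy_classes: "\<Union>(conjugacy_classes G) = carrier G"
  unfolding conjugacy_classes_def
  by (rule group_action.orbits_coverture[OF action_by_conjugation])

lemma (in group) torsion_class_count_exponent:
  assumes "\<And>x. x \<in> carrier G \<Longrightarrow> x [^] (q::nat) = \<one>"
  shows "torsion_class_count G q = card (conjugacy_classes G)"
proof -
  have "x \<in> carrier G" if "C \<in> conjugacy_classes G" "x \<in> C" for C x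
    using that Union_conjugacy_classes by blast
  then show ?thesis using assms unfolding torsion_class_count_def
    by (intro arg_cong[where f = card]) blast
qed

text \<open>An isomorphism maps commuting pairs to commuting pairs, so the invariance of the class count
  follows from that of the pair count.\<close>

lemma torsion_class_count_iso:
  assumes "group G" "group H" "h \<in> iso G H" "finite (carrier G)"
  shows "torsion_class_count G q = torsion_class_count H q"
proof -
  interpret G: group G by fact
  interpret H: group H by fact
  have hom: "h \<in> hom G H" and bij: "bij_betw h (carrier G) (carrier H)"
    using assms(3) by (auto simp: iso_def)
  interpret h: group_hom G H h using hom by unfold_locales
  have inj: "h x = h y \<longleftrightarrow> x = y" if "x \<in> carrier G" "y \<in> carrier G" for x y
    using bij that by (auto simp: bij_betw_def inj_on_def)
  have finH: "finite (carrier H)" using bij assms(4) bij_betw_finite by blast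
  have comm: "h x \<otimes>\<^bsub>H\<^esub> h y = h y \<otimes>\<^bsub>H\<^esub> h x \<longleftrightarrow> x \<otimes>\<^bsub>G\<^esub> y = y \<otimes>\<^bsub>G\<^esub> x"
    if "x \<in> carrier G" "y \<in> carrier G" for x y
    using that by (simp add: inj flip: h.hom_mult)
  have pow: "h x [^]\<^bsub>H\<^esub> q = \<one>\<^bsub>H\<^esub> \<longleftrightarrow> x [^]\<^bsub>G\<^esub> q = \<one>\<^bsub>G\<^esub>" if "x \<in> carrier G" for x
    using that inj[of "x [^]\<^bsub>G\<^esub> q" "\<one>\<^bsub>G\<^esub>"] by (simp add: h.hom_nat_pow)
  have "map_prod h h ` commuting_pairs G q = commuting_pairs H q"
  proof -
    have "carrier H = h ` carrier G" using bij by (simp add: bij_betw_def)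
    then show ?thesis
      by (auto simp: commuting_pairs_def comm pow image_iff)
  qed
  moreover have "inj_on (map_prod h h) (commuting_pairs G q)"
    by (rule inj_onI) (auto simp: commuting_pairs_def inj)
  ultimately have "card (commuting_pairs G q) = card (commuting_pairs H q)"
    by (metis card_image)
  moreover have "order G = order H" using bij by (simp add: order_def bij_betw_same_card)
  moreover have "order G > 0" using assms(4) G.order_gt_0_iff_finite by simp
  ultimately show ?thesis
    using G.card_commuting_pairs[OF assms(4), of q] H.card_commuting_pairs[OF finH, of q] by simp
qed

text \<open>Orders in a group of prime power order are powers of \<open>p\<close>, for which size and divisibility
  agree.\<close>

lemma (in group) ord_le_prime_power_iff:
  assumes "Factorial_Ring.prime p" "order G = p ^ e" "x \<in> carrier G"
  shows "ord x \<le> p ^ k \<longleftrightarrow> x [^] (p ^ k) = \<one>"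
proof -
  have p: "p > 1" using assms(1) by (rule prime_gt_1_nat)
  have "ord x dvd p ^ e" using ord_dvd_group_order[OF assms(3)] assms(2) by simp
  then obtain m where m: "ord x = p ^ m" using assms(1) by (auto simp: divides_primepow_nat)
  show ?thesis using p by (simp add: pow_eq_id[OF assms(3)] m power_le_imp_le_exp
      dvd_power_iff_le power_increasing_iff)
qed

section \<open>Conjugacy of Sylow subgroups\<close>

lemma group_actionI:
  assumes "group G"
    and closed: "\<And>g x. g \<in> carrier G \<Longrightarrow> x \<in> E \<Longrightarrow> f g x \<in> E"
    and one: "\<And>x. x \<in> E \<Longrightarrow> f \<one>\<^bsub>G\<^esub> x = x"
    and mult: "\<And>g h x. g \<in> carrier G \<Longrightarrow> h \<in> carrier G \<Longrightarrow> x \<in> E \<Longrightarrow>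
      f (g \<otimes>\<^bsub>G\<^esub> h) x = f g (f h x)"
  shows "group_action G E (\<lambda>g. \<lambda>x\<in>E. f g x)"
proof -
  interpret group G by fact
  have inv: "f (inv\<^bsub>G\<^esub> g) (f g x) = x" "f g (f (inv\<^bsub>G\<^esub> g) x) = x"
    if "g \<in> carrier G" "x \<in> E" for g x
    using that by (simp_all add: one flip: mult)
  have Bij: "(\<lambda>x\<in>E. f g x) \<in> Bij E" if "g \<in> carrier G" for g
  proof -
    have "bij_betw (f g) E E"
      by (rule bij_betw_byWitness[where f' = "f (inv\<^bsub>G\<^esub> g)"]) (use that in \<open>auto simp: inv closed\<close>)
    then show ?thesis by (simp add: Bij_def)
  qed
  show ?thesis
    unfolding group_action_def group_hom_def group_hom_axioms_def
    using group_BijGroup[of E] Bij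
    by (auto intro!: homI restrict_ext simp: is_group BijGroup_def mult closed compose_def)
qed

text \<open>\<open>K \<times> H\<close> acts on \<open>G\<close> by \<open>(k, h) \<bullet> x = k x h\<inverse>\<close>; the orbits are double cosets.  All orbit sizes
  are powers of \<open>p\<close>, and they cannot all exceed the power of \<open>p\<close> in the order of \<open>G\<close>.  For \<open>x\<close> in
  an orbit that does not, the stabilizer has at least as many elements as \<open>K\<close>.  It consists of
  pairs \<open>(k, x\<inverse> k x)\<close>, so every element of \<open>K\<close> occurs and \<open>x\<close> conjugates \<open>K\<close> into \<open>H\<close>.\<close>

theorem (in group) sylow_conjugate:
  assumes p: "Factorial_Ring.prime p"
    and H: "is_sylow_subgroup p G H" and K: "is_sylow_subgroup p G K"
  obtains g where "g \<in> carrier G" "(\<lambda>k. inv g \<otimes> k \<otimes> g) ` K = H"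
proof -
  define a where "a = multiplicity p (order G)"
  have fin: "finite (carrier G)" and subH: "subgroup H G" and subK: "subgroup K G"
    and cH: "card H = p ^ a" and cK: "card K = p ^ a"
    using H K by (auto simp: is_sylow_subgroup_def a_def)
  let ?GH = "G\<lparr>carrier := H\<rparr>" and ?GK = "G\<lparr>carrier := K\<rparr>"
  have gH: "group ?GH" and gK: "group ?GK"
    using subH subK by (auto simp: subgroup_imp_group)
  have HG: "\<And>x. x \<in> H \<Longrightarrow> x \<in> carrier G" and KG: "\<And>x. x \<in> K \<Longrightarrow> x \<in> carrier G"
    using subH subK subgroup.mem_carrier by metis+
  let ?D = "?GK \<times>\<times> ?GH"
  let ?f = "\<lambda>(k, h) x. k \<otimes> x \<otimes> inv h"
  have D: "group ?D" using gK gH by (rule DirProd_group)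
  interpret act: group_action ?D "carrier G" "\<lambda>kh. \<lambda>x\<in>carrier G. ?f kh x"
    by (rule group_actionI[OF D])
       (auto simp: HG KG m_assoc inv_mult_group)
  have ordD: "order ?D = p ^ (a + a)"
    by (simp add: order_def DirProd_def card_cartesian_product cH cK power_add)
  let ?orb = "orbit ?D (\<lambda>kh. \<lambda>x\<in>carrier G. ?f kh x)"
  let ?stab = "stabilizer ?D (\<lambda>kh. \<lambda>x\<in>carrier G. ?f kh x)"
  have "\<exists>x\<in>carrier G. \<exists>b\<le>a. card (?orb x) = p ^ b"
  proof (rule ccontr)
    assume no: "\<not> ?thesis"
    have "p ^ Suc a dvd card (?orb x)" if "x \<in> carrier G" for x
    proof -
      have "card (?orb x) dvd p ^ (a + a)"
        using act.orbit_stabilizer_theorem[OF that] ordD by (metis dvd_triv_left)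
      then obtain b where b: "card (?orb x) = p ^ b" using p by (auto simp: divides_primepow_nat)
      then have "\<not> b \<le> a" using no that by blast
      then show ?thesis by (simp only: b le_imp_power_dvd not_le Suc_le_eq)
    qed
    then have "p ^ Suc a dvd (\<Sum>orb\<in>orbits ?D (carrier G) (\<lambda>kh. \<lambda>x\<in>carrier G. ?f kh x). card orb)"
      by (intro dvd_sum) (auto simp: orbits_def simp del: power_Suc)
    also have "\<dots> = card (carrier G)" using act.disjoint_sum[OF fin, of "\<lambda>_. 1::nat"] by simp
    finally have "p ^ Suc a dvd order G" by (simp add: order_def)
    moreover have "order G \<noteq> 0" using fin order_gt_0_iff_finite by simp
    ultimately have "Suc a \<le> multiplicity p (order G)"
      using p by (intro multiplicity_geI) auto
    then show False by (simp add: a_def)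
  qed
  then obtain x b where x: "x \<in> carrier G" and b: "card (?orb x) = p ^ b" and "b \<le> a"
    by blast
  have "p ^ b * card (?stab x) = p ^ (a + a)"
    using act.orbit_stabilizer_theorem[OF x] ordD b by simp
  moreover have "p ^ (a + a) = p ^ b * p ^ (a - b + a)"
    using \<open>b \<le> a\<close> by (simp flip: power_add)
  moreover have "p > 0" using p prime_gt_0_nat by blast
  ultimately have "card (?stab x) = p ^ (a - b + a)" by simp
  then have big: "card K \<le> card (?stab x)" using \<open>p > 0\<close> by (simp add: cK power_increasing)
  have stab: "k \<in> K \<and> h \<in> H \<and> h = inv x \<otimes> k \<otimes> x" if "(k, h) \<in> ?stab x" for k h
  proof -
    have kh: "k \<in> K" "h \<in> H" "k \<otimes> x \<otimes> inv h = x"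
      using that x by (auto simp: stabilizer_def DirProd_def)
    then have "k \<otimes> x = x \<otimes> h" using x HG KG by (metis inv_solve_right' m_closed)
    then have "h = inv x \<otimes> (k \<otimes> x)" using kh x HG KG by (metis inv_solve_left m_closed)
    then show ?thesis using kh x HG KG by (simp add: m_assoc)
  qed
  have finK: "finite K" using fin KG by (meson finite_subset subsetI)
  have finH: "finite H" using fin HG by (meson finite_subset subsetI)
  have "inj_on fst (?stab x)" by (rule inj_onI) (metis prod.collapse stab)
  then have "card (fst ` ?stab x) = card (?stab x)" by (rule card_image)
  moreover have sub: "fst ` ?stab x \<subseteq> K" using stab by fastforce
  ultimately have "fst ` ?stab x = K" using big finK by (metis card_seteq)
  then have "inv x \<otimes> k \<otimes> x \<in> H" if "k \<in> K" for k using that stab by force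
  moreover have "inj_on (\<lambda>k. inv x \<otimes> k \<otimes> x) K"
    using x KG by (auto intro!: inj_onI)
  ultimately have "(\<lambda>k. inv x \<otimes> k \<otimes> x) ` K = H"
    by (intro card_subset_eq finH) (auto simp: card_image cH cK)
  then show thesis using that x by blast
qed

corollary (in group) sylow_subgroups_isomorphic:
  assumes "Factorial_Ring.prime p"
    and H: "is_sylow_subgroup p G H" and K: "is_sylow_subgroup p G K"
  shows "\<exists>h. h \<in> iso (G\<lparr>carrier := K\<rparr>) (G\<lparr>carrier := H\<rparr>)"
proof -
  obtain g where g: "g \<in> carrier G" and im: "(\<lambda>k. inv g \<otimes> k \<otimes> g) ` K = H"
    using sylow_conjugate[OF assms] .
  have KG: "\<And>x. x \<in> K \<Longrightarrow> x \<in> carrier G"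
    using K subgroup.mem_carrier unfolding is_sylow_subgroup_def by metis
  have "inv g \<otimes> (k \<otimes> l) \<otimes> g = inv g \<otimes> k \<otimes> g \<otimes> (inv g \<otimes> l \<otimes> g)" if "k \<in> K" "l \<in> K" for k l
  proof -
    have "g \<otimes> (inv g \<otimes> (l \<otimes> g)) = l \<otimes> g" using that KG g by (simp flip: m_assoc)
    then show ?thesis using that KG g by (simp add: m_assoc)
  qed
  moreover have "inj_on (\<lambda>k. inv g \<otimes> k \<otimes> g) K"
    using g KG by (auto intro!: inj_onI)
  ultimately have "(\<lambda>k. inv g \<otimes> k \<otimes> g) \<in> iso (G\<lparr>carrier := K\<rparr>) (G\<lparr>carrier := H\<rparr>)"
    using im by (auto simp: iso_def hom_def bij_betw_def)
  then show ?thesis by blast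
qed

section \<open>The wreath product with a cyclic group of prime order\<close>

lemma periodic_cong:
  fixes x :: "int \<Rightarrow> 'a"
  assumes per: "\<And>a. x (a + int p) = x a" and "a mod int p = b mod int p"
  shows "x a = x b"
proof -
  have nonneg: "x (a + int p * int k) = x a" for a k
  proof (induction k)
    case (Suc k)
    then show ?case using per[of "a + int p * int k"] by (simp add: algebra_simps)
  qed simp
  obtain k where k: "b = a + int p * k"
    using assms(2) by (metis mod_eqE)
  show ?thesis
  proof (cases "k \<ge> 0")
    case True
    then show ?thesis using nonneg[of a "nat k"] k by simp
  next
    case False
    then show ?thesis using nonneg[of b "nat (- k)"] k by simp
  qed
qed

definition periodic_functions :: "nat \<Rightarrow> 'a set \<Rightarrow> (int \<Rightarrow> 'a) set" where
  "periodic_functions p A = {x. \<forall>a. x a \<in> A \<and> x (a + int p) = x a}"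

lemma card_periodic_functions:
  assumes "p > 0"
  shows "card (periodic_functions p A) = card A ^ p"
proof -
  have "bij_betw (\<lambda>x. restrict x {0..<int p}) (periodic_functions p A) ({0..<int p} \<rightarrow>\<^sub>E A)"
  proof (rule bij_betw_byWitness[where f' = "\<lambda>f a. f (a mod int p)"])
    have "x (a mod int p) = x a" if "x \<in> periodic_functions p A" for x a
      by (rule periodic_cong[where p = p]) (use that in \<open>auto simp: periodic_functions_def\<close>)
    then show "\<forall>x\<in>periodic_functions p A. (\<lambda>a. restrict x {0..<int p} (a mod int p)) = x"
      using assms by (simp add: fun_eq_iff)
    show "\<forall>f\<in>{0..<int p} \<rightarrow>\<^sub>E A. restrict (\<lambda>a. f (a mod int p)) {0..<int p} = f"
      by (auto simp: fun_eq_iff restrict_def PiE_def extensional_def)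
    show "(\<lambda>x. restrict x {0..<int p}) ` periodic_functions p A \<subseteq> {0..<int p} \<rightarrow>\<^sub>E A"
      by (auto simp: periodic_functions_def)
    show "(\<lambda>f a. f (a mod int p)) ` ({0..<int p} \<rightarrow>\<^sub>E A) \<subseteq> periodic_functions p A"
      using assms by (auto simp: periodic_functions_def PiE_def Pi_def)
  qed
  then have "card (periodic_functions p A) = card ({0..<int p} \<rightarrow>\<^sub>E A)"
    by (rule bij_betw_same_card)
  then show ?thesis by (simp add: card_PiE)
qed

text \<open>\<open>(j, y)\<close> stands for the permutation of \<open>p\<close> copies of a set that sends the point \<open>v\<close> of copy \<open>a\<close>
  to the point \<open>y a v\<close> of copy \<open>a + j\<close>.  Coordinates are \<open>p\<close>-periodic functions on the integers,
  so that indices can be shifted without reducing them modulo \<open>p\<close>.\<close>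

definition wreath :: "('a, 'b) monoid_scheme \<Rightarrow> nat \<Rightarrow> (int \<times> (int \<Rightarrow> 'a)) monoid" where
  "wreath G p = \<lparr>carrier = {0..<int p} \<times> periodic_functions p (carrier G),
     monoid.mult = \<lambda>(j, y) (i, z). ((j + i) mod int p, \<lambda>a. y (a + i) \<otimes>\<^bsub>G\<^esub> z a),
     monoid.one = (0, (\<lambda>_. \<one>\<^bsub>G\<^esub>))\<rparr>"

locale prime_wreath = group G for G (structure) +
  fixes p :: nat
  assumes fin: "finite (carrier G)" and prime_p: "Factorial_Ring.prime p"
begin

abbreviation W where "W \<equiv> wreath G p"

lemma p_pos: "p > 0" using prime_p by (rule prime_gt_0_nat)

lemma p_gt_1: "p > 1" using prime_p by (rule prime_gt_1_nat)

lemma mem_wreath_iff: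
  "t \<in> carrier W \<longleftrightarrow> 0 \<le> fst t \<and> fst t < int p \<and> (\<forall>a. snd t a \<in> carrier G) \<and>
     (\<forall>a. snd t (a + int p) = snd t a)"
  by (cases t) (auto simp: wreath_def periodic_functions_def)

lemma snd_closed [simp]: "t \<in> carrier W \<Longrightarrow> snd t a \<in> carrier G"
  by (simp add: mem_wreath_iff)

lemma snd_cong: "t \<in> carrier W \<Longrightarrow> a mod int p = b mod int p \<Longrightarrow> snd t a = snd t b"
  by (rule periodic_cong[where p = p]) (auto simp: mem_wreath_iff)

lemma fst_mod [simp]: "t \<in> carrier W \<Longrightarrow> fst t mod int p = fst t"
  by (simp add: mem_wreath_iff)

lemma fst_mult: "fst (s \<otimes>\<^bsub>W\<^esub> t) = (fst s + fst t) mod int p"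
  by (simp add: wreath_def split: prod.splits)

lemma snd_mult: "snd (s \<otimes>\<^bsub>W\<^esub> t) a = snd s (a + fst t) \<otimes> snd t a"
  by (simp add: wreath_def split: prod.splits)

lemma one_wreath: "\<one>\<^bsub>W\<^esub> = (0, \<lambda>_. \<one>)"
  by (simp add: wreath_def)

lemma mult_closed:
  assumes s: "s \<in> carrier W" and t: "t \<in> carrier W"
  shows "s \<otimes>\<^bsub>W\<^esub> t \<in> carrier W"
proof -
  have "snd s (a + int p + fst t) = snd s (a + fst t)" for a
    by (rule snd_cong[OF s]) (metis add.assoc add.commute mod_add_self2)
  then show ?thesis using s t p_pos by (auto simp: mem_wreath_iff fst_mult snd_mult)
qed

lemma group_wreath: "group W"
proof (rule groupI)
  show "x \<otimes>\<^bsub>W\<^esub> y \<otimes>\<^bsub>W\<^esub> z = x \<otimes>\<^bsub>W\<^esub> (y \<otimes>\<^bsub>W\<^esub> z)"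
    if xyz: "x \<in> carrier W" "y \<in> carrier W" "z \<in> carrier W" for x y z
  proof (rule prod_eqI)
    show "fst (x \<otimes>\<^bsub>W\<^esub> y \<otimes>\<^bsub>W\<^esub> z) = fst (x \<otimes>\<^bsub>W\<^esub> (y \<otimes>\<^bsub>W\<^esub> z))"
      by (simp add: fst_mult mod_simps add.assoc)
    have "snd x (a + (fst y + fst z) mod int p) = snd x (a + fst z + fst y)" for a
      by (rule snd_cong[OF xyz(1)]) (simp add: mod_simps algebra_simps)
    then show "snd (x \<otimes>\<^bsub>W\<^esub> y \<otimes>\<^bsub>W\<^esub> z) = snd (x \<otimes>\<^bsub>W\<^esub> (y \<otimes>\<^bsub>W\<^esub> z))"
      using xyz by (simp add: fun_eq_iff snd_mult fst_mult m_assoc)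
  qed
  show one: "\<one>\<^bsub>W\<^esub> \<in> carrier W" using p_pos by (simp add: mem_wreath_iff one_wreath)
  show "\<one>\<^bsub>W\<^esub> \<otimes>\<^bsub>W\<^esub> x = x" if "x \<in> carrier W" for x
    using that by (intro prod_eqI) (simp_all add: fun_eq_iff snd_mult fst_mult one_wreath)
  show "\<exists>y\<in>carrier W. y \<otimes>\<^bsub>W\<^esub> x = \<one>\<^bsub>W\<^esub>" if x: "x \<in> carrier W" for x
  proof (rule bexI)
    let ?y = "((- fst x) mod int p, \<lambda>a. inv (snd x (a - fst x)))"
    show "?y \<in> carrier W" using x p_pos
      by (auto simp: mem_wreath_iff[of ?y] intro!: arg_cong[where f = "m_inv G"] snd_cong)
         (simp add: diff_add_eq[symmetric])
    show "?y \<otimes>\<^bsub>W\<^esub> x = \<one>\<^bsub>W\<^esub>"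
      using x by (intro prod_eqI) (simp_all add: fun_eq_iff snd_mult fst_mult one_wreath mod_simps)
  qed
qed (fact mult_closed)

sublocale W: group W by (rule group_wreath)

lemma order_wreath: "order W = p * order G ^ p"
  using p_pos by (simp add: order_def wreath_def card_cartesian_product card_periodic_functions)

lemma card_fst_nonzero:
  "card {t \<in> carrier W. fst t \<noteq> 0} = (p - 1) * order G ^ p"
proof -
  have "{t \<in> carrier W. fst t \<noteq> 0} = {1..<int p} \<times> periodic_functions p (carrier G)"
    by (auto simp: wreath_def)
  then show ?thesis using p_pos
    by (simp add: card_cartesian_product card_periodic_functions order_def nat_diff_distrib)
qed

lemma finite_wreath: "finite (carrier W)"
  using W.order_gt_0_iff_finite order_wreath p_pos fin order_gt_0_iff_finite by simp

lemma base_pow: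
  assumes "s \<in> carrier W" "fst s = 0"
  shows "s [^]\<^bsub>W\<^esub> (n::nat) = (0, \<lambda>a. snd s a [^] n)"
proof (induction n)
  case (Suc n)
  have "s [^]\<^bsub>W\<^esub> Suc n = (0, \<lambda>a. snd s a [^] n) \<otimes>\<^bsub>W\<^esub> s" using Suc by simp
  then show ?case using assms
    by (intro prod_eqI) (simp_all add: fst_mult snd_mult fun_eq_iff)
qed (simp add: one_wreath)

lemma fst_pow:
  assumes "t \<in> carrier W"
  shows "fst (t [^]\<^bsub>W\<^esub> (m::nat)) = (int m * fst t) mod int p"
  by (induction m) (use assms in \<open>auto simp: one_wreath fst_mult mod_simps algebra_simps\<close>)

text \<open>The coordinate of a power of \<open>t\<close> at \<open>a\<close> collects the coordinates of \<open>t\<close> met on the way from \<open>a\<close>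
  in steps of \<open>fst t\<close>.\<close>

lemma snd_pow_Suc:
  assumes "t \<in> carrier W"
  shows "snd (t [^]\<^bsub>W\<^esub> Suc m) a = snd t (a + int m * fst t) \<otimes> snd (t [^]\<^bsub>W\<^esub> m) a"
proof -
  have "snd (t [^]\<^bsub>W\<^esub> Suc m) a = snd t (a + fst (t [^]\<^bsub>W\<^esub> m)) \<otimes> snd (t [^]\<^bsub>W\<^esub> m) a"
    using assms by (simp only: W.nat_pow_Suc2 snd_mult)
  then show ?thesis using assms
    by (simp add: fst_pow) (metis (no_types, lifting) mod_add_right_eq snd_cong)
qed

text \<open>A nonzero shift generates the integers modulo the prime \<open>p\<close>: with \<open>d\<close> inverse to \<open>fst t\<close>, the
  index \<open>a\<close> is reached from \<open>0\<close> after \<open>a d mod p\<close> steps.\<close>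

lemma reach_by_shift:
  assumes "t \<in> carrier W" "fst t \<noteq> 0"
  obtains d where "\<And>a. (int (nat ((a * d) mod int p)) * fst t) mod int p = a mod int p"
proof -
  have "\<not> int p dvd fst t" using assms by (auto simp: mem_wreath_iff dest: zdvd_imp_le)
  moreover have "Factorial_Ring.prime (int p)" using prime_p by simp
  ultimately have "coprime (fst t) (int p)"
    using prime_imp_coprime coprime_commute by blast
  then obtain d where d: "[fst t * d = 1] (mod int p)" using cong_solve_coprime_int by blast
  have "(int (nat ((a * d) mod int p)) * fst t) mod int p = a mod int p" for a
  proof -
    have "(int (nat ((a * d) mod int p)) * fst t) mod int p = (a * (fst t * d)) mod int p"
      using p_pos by (simp add: mod_simps ac_simps)
    also have "\<dots> = a * 1 mod int p"
      using cong_scalar_left[OF d, of a] by (simp add: cong_def)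
    finally show ?thesis by simp
  qed
  then show thesis by (rule that)
qed

section \<open>Centralizers in the wreath product\<close>

text \<open>As \<open>t [^] p\<close> lies in the base, its coordinate at \<open>0\<close> is the product of all coordinates of \<open>t\<close>,
  taken along the cycle from \<open>0\<close> in steps of \<open>fst t\<close>.\<close>

definition cycle_product :: "int \<times> (int \<Rightarrow> 'a) \<Rightarrow> 'a" where
  "cycle_product t = snd (t [^]\<^bsub>W\<^esub> p) 0"

definition base_centralizer :: "int \<times> (int \<Rightarrow> 'a) \<Rightarrow> (int \<times> (int \<Rightarrow> 'a)) set" where
  "base_centralizer t = {s \<in> carrier W. fst s = 0 \<and> s \<otimes>\<^bsub>W\<^esub> t = t \<otimes>\<^bsub>W\<^esub> s}"

lemma cycle_product_closed [simp]: "t \<in> carrier W \<Longrightarrow> cycle_product t \<in> carrier G"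
  by (simp add: cycle_product_def)

lemma base_centralizer_iff:
  assumes "s \<in> carrier W" "fst s = 0" "t \<in> carrier W"
  shows "s \<in> base_centralizer t \<longleftrightarrow> (\<forall>a. snd s (a + fst t) \<otimes> snd t a = snd t a \<otimes> snd s a)"
  using assms by (auto simp: base_centralizer_def prod_eq_iff fst_mult snd_mult fun_eq_iff)

lemma base_centralizer_pow:
  assumes t: "t \<in> carrier W" and s: "s \<in> base_centralizer t"
  shows "snd s (int m * fst t) \<otimes> snd (t [^]\<^bsub>W\<^esub> (m::nat)) 0 = snd (t [^]\<^bsub>W\<^esub> m) 0 \<otimes> snd s 0"
proof -
  have sW: "s \<in> carrier W" "fst s = 0" and "s \<otimes>\<^bsub>W\<^esub> t = t \<otimes>\<^bsub>W\<^esub> s"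
    using s by (auto simp: base_centralizer_def)
  then have "s \<otimes>\<^bsub>W\<^esub> t [^]\<^bsub>W\<^esub> m = t [^]\<^bsub>W\<^esub> m \<otimes>\<^bsub>W\<^esub> s"
    using W.commutes_pow t by blast
  then have "s \<in> base_centralizer (t [^]\<^bsub>W\<^esub> m)" using sW by (simp add: base_centralizer_def)
  then have "snd s (fst (t [^]\<^bsub>W\<^esub> m)) \<otimes> snd (t [^]\<^bsub>W\<^esub> m) 0 = snd (t [^]\<^bsub>W\<^esub> m) 0 \<otimes> snd s 0"
    using base_centralizer_iff[OF sW, of "t [^]\<^bsub>W\<^esub> m"] t by (metis W.nat_pow_closed add_0)
  moreover have "snd s (fst (t [^]\<^bsub>W\<^esub> m)) = snd s (int m * fst t)"
    by (rule snd_cong[OF sW(1)]) (simp add: fst_pow t)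
  ultimately show ?thesis by simp
qed

text \<open>Commuting with the powers of \<open>t\<close> ties each coordinate to the one at \<open>0\<close> by a conjugation, since
  the shift of \<open>t\<close> reaches every index.\<close>

lemma base_centralizer_inj:
  assumes t: "t \<in> carrier W" "fst t \<noteq> 0"
    and r: "r \<in> base_centralizer t" and s: "s \<in> base_centralizer t"
    and eq: "snd r 0 = snd s 0"
  shows "r = s"
proof (rule prod_eqI)
  show "fst r = fst s" using r s by (simp add: base_centralizer_def)
  have W: "r \<in> carrier W" "s \<in> carrier W" using r s by (simp_all add: base_centralizer_def)
  obtain d where d: "\<And>a. (int (nat ((a * d) mod int p)) * fst t) mod int p = a mod int p"
    using reach_by_shift[OF t] by blast
  show "snd r = snd s"
  proof
    fix a
    let ?m = "nat ((a * d) mod int p)"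
    have "snd r (int ?m * fst t) = snd s (int ?m * fst t)"
      using base_centralizer_pow[OF t(1) r, of ?m] base_centralizer_pow[OF t(1) s, of ?m] eq W t
      by (metis W.nat_pow_closed right_cancel snd_closed)
    then show "snd r a = snd s a" using d W snd_cong by metis
  qed
qed

text \<open>Given \<open>u\<close> at index \<open>0\<close>, the other coordinates are obtained by conjugating \<open>u\<close> step by step along
  the cycle.  After \<open>p\<close> steps the cycle is back at \<open>0\<close>, and the construction closes up exactly if
  \<open>u\<close> commutes with the product along the cycle.\<close>

lemma bij_base_centralizer:
  assumes t: "t \<in> carrier W" "fst t \<noteq> 0"
  shows "bij_betw (\<lambda>s. snd s 0) (base_centralizer t)
     {u \<in> carrier G. u \<otimes> cycle_product t = cycle_product t \<otimes> u}"
  unfolding bij_betw_def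
proof (intro conjI)
  show "inj_on (\<lambda>s. snd s 0) (base_centralizer t)"
    using base_centralizer_inj[OF t] by (auto intro: inj_onI)
  obtain d where d: "\<And>a. (int (nat ((a * d) mod int p)) * fst t) mod int p = a mod int p"
    using reach_by_shift[OF t] by blast
  define Y where "Y m = snd (t [^]\<^bsub>W\<^esub> (m::nat)) 0" for m
  have Y [simp]: "Y m \<in> carrier G" for m using t by (simp add: Y_def)
  have Y0: "Y 0 = \<one>" by (simp add: Y_def one_wreath)
  have Yp: "Y p = cycle_product t" by (simp add: Y_def cycle_product_def)
  have YSuc: "Y (Suc m) = snd t (int m * fst t) \<otimes> Y m" for m
    unfolding Y_def snd_pow_Suc[OF t(1)] by simp
  show "(\<lambda>s. snd s 0) ` base_centralizer t =
    {u \<in> carrier G. u \<otimes> cycle_product t = cycle_product t \<otimes> u}"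
  proof (intro equalityI subsetI)
    fix u assume "u \<in> (\<lambda>s. snd s 0) ` base_centralizer t"
    then obtain s where s: "s \<in> base_centralizer t" "u = snd s 0" by blast
    then have sW: "s \<in> carrier W" by (simp add: base_centralizer_def)
    have "snd s (int p * fst t) = snd s 0" by (rule snd_cong[OF sW]) simp
    then show "u \<in> {u \<in> carrier G. u \<otimes> cycle_product t = cycle_product t \<otimes> u}"
      using base_centralizer_pow[OF t(1) s(1), of p] sW s(2) by (simp add: cycle_product_def)
  next
    fix u assume "u \<in> {u \<in> carrier G. u \<otimes> cycle_product t = cycle_product t \<otimes> u}"
    then have u: "u \<in> carrier G" and comm: "u \<otimes> Y p = Y p \<otimes> u" by (auto simp: Yp)
    \<comment> \<open>\<open>m a\<close> is the number of steps from \<open>0\<close> to \<open>a\<close>, and \<open>b\<close> the function built from \<open>u\<close>.\<close>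
    define m where "m a = nat ((a * d) mod int p)" for a
    define b where "b a = Y (m a) \<otimes> u \<otimes> inv (Y (m a))" for a
    have b [simp]: "b a \<in> carrier G" for a using u by (simp add: b_def)
    have m_int: "int (m a) = (a * d) mod int p" for a using p_pos by (simp add: m_def)
    have m_less: "m a < p" for a
    proof -
      have "int (m a) < int p" using p_pos by (simp add: m_int)
      then show ?thesis by simp
    qed
    have m_d: "(int (m a) * fst t) mod int p = a mod int p" for a using d by (simp add: m_def)
    have d1: "(fst t * d) mod int p = 1"
      using d[of 1] p_pos p_gt_1 by (simp add: mod_simps mult.commute)
    have m_step: "m (a + fst t) = Suc (m a) mod p" for a
    proof -
      have "int (m (a + fst t)) = (a * d + fst t * d) mod int p"
        by (simp add: m_int distrib_right)
      also have "\<dots> = ((a * d) mod int p + (fst t * d) mod int p) mod int p"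
        by (simp add: mod_simps)
      also have "\<dots> = (int (m a) + 1) mod int p" by (simp only: m_int d1)
      also have "\<dots> = int (Suc (m a) mod p)" by (simp add: zmod_int add.commute)
      finally show ?thesis by simp
    qed
    have b_step: "b (a + fst t) \<otimes> snd t a = snd t a \<otimes> b a" for a
    proof -
      have conj: "b (a + fst t) = Y (Suc (m a)) \<otimes> u \<otimes> inv (Y (Suc (m a)))"
      proof (cases "Suc (m a) < p")
        case True
        then show ?thesis by (simp add: b_def m_step)
      next
        case False
        then have "Suc (m a) = p" using m_less[of a] by simp
        moreover have "Y p \<otimes> u \<otimes> inv (Y p) = u" using comm u by (simp add: commute_iff_conj_eq)
        ultimately show ?thesis using u by (simp add: b_def m_step Y0)
      qed
      have "snd t (int (m a) * fst t) = snd t a" by (rule snd_cong[OF t(1)]) (simp add: m_d)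
      then have Y': "Y (Suc (m a)) = snd t a \<otimes> Y (m a)" by (simp add: YSuc)
      have "b (a + fst t) = snd t a \<otimes> b a \<otimes> inv (snd t a)"
        unfolding conj Y' using u t by (simp add: b_def[of a] m_assoc inv_mult_group)
      then show ?thesis using t by (simp add: m_assoc)
    qed
    have "m (a + int p) = m a" for a by (simp add: m_def distrib_right)
    then have sW: "(0, b) \<in> carrier W" using p_pos by (simp add: mem_wreath_iff b_def[abs_def] u)
    then have "(0, b) \<in> base_centralizer t"
      using base_centralizer_iff[OF sW _ t(1)] b_step by simp
    moreover have "b 0 = u" using u by (simp add: b_def m_def Y0)
    ultimately show "u \<in> (\<lambda>s. snd s 0) ` base_centralizer t" by force
  qed
qed

text \<open>Powers of \<open>s\<close> and the unit both lie in the centralizer of \<open>t\<close>, where elements are determined by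
  their coordinate at \<open>0\<close>.\<close>

lemma base_pow_eq_one_iff:
  assumes t: "t \<in> carrier W" "fst t \<noteq> 0" and s: "s \<in> base_centralizer t"
  shows "s [^]\<^bsub>W\<^esub> (r::nat) = \<one>\<^bsub>W\<^esub> \<longleftrightarrow> snd s 0 [^] r = \<one>"
proof -
  have sW: "s \<in> carrier W" "fst s = 0" "s \<otimes>\<^bsub>W\<^esub> t = t \<otimes>\<^bsub>W\<^esub> s"
    using s by (auto simp: base_centralizer_def)
  note pow = base_pow[OF sW(1,2), of r]
  have "s [^]\<^bsub>W\<^esub> r \<in> base_centralizer t"
    using sW t W.commutes_pow[OF t(1) sW(1), of r] W.nat_pow_closed[OF sW(1), of r]
    by (simp add: base_centralizer_def pow)
  moreover have "\<one>\<^bsub>W\<^esub> \<in> base_centralizer t" using t by (simp add: base_centralizer_def one_wreath[symmetric])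
     (simp add: one_wreath)
  ultimately have "snd (s [^]\<^bsub>W\<^esub> r) 0 = snd \<one>\<^bsub>W\<^esub> 0 \<Longrightarrow> s [^]\<^bsub>W\<^esub> r = \<one>\<^bsub>W\<^esub>"
    using base_centralizer_inj[OF t] by blast
  then show ?thesis by (auto simp: pow one_wreath dest: fun_cong[where x = 0])
qed

text \<open>\<open>t [^] p\<close> is a base element commuting with \<open>t\<close>, and its coordinate at \<open>0\<close> is the cycle product;
  so \<open>base_pow_eq_one_iff\<close> applies to it.\<close>

lemma pow_eq_one_iff_cycle_product:
  assumes t: "t \<in> carrier W" "fst t \<noteq> 0"
  shows "t [^]\<^bsub>W\<^esub> (p * r) = \<one>\<^bsub>W\<^esub> \<longleftrightarrow> cycle_product t [^] r = \<one>"
proof -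
  have "t [^]\<^bsub>W\<^esub> p \<in> base_centralizer t"
    using t by (simp add: base_centralizer_def fst_pow) (metis W.nat_pow_Suc W.nat_pow_Suc2)
  then have "(t [^]\<^bsub>W\<^esub> p) [^]\<^bsub>W\<^esub> r = \<one>\<^bsub>W\<^esub> \<longleftrightarrow> cycle_product t [^] r = \<one>"
    using base_pow_eq_one_iff[OF t] by (simp add: cycle_product_def)
  then show ?thesis using t by (simp add: W.nat_pow_pow)
qed

lemma wreath_pow_eq_one:
  assumes exp: "\<And>u. u \<in> carrier G \<Longrightarrow> u [^] (r::nat) = \<one>" and t: "t \<in> carrier W"
  shows "t [^]\<^bsub>W\<^esub> (p * r) = \<one>\<^bsub>W\<^esub>"
proof (cases "fst t = 0")
  case True
  have "snd t a [^] (p * r) = \<one>" for a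
    using exp[of "snd t a"] t nat_pow_pow[of "snd t a" r p] by (simp add: mult.commute)
  then show ?thesis using base_pow[OF t True] by (simp add: one_wreath)
next
  case False
  then show ?thesis using pow_eq_one_iff_cycle_product[OF t] exp t by simp
qed

text \<open>The powers of \<open>t\<close> commute with \<open>t\<close> and realize every shift; multiplication by them carries the
  part of the centralizer in the base onto the part with any other shift.\<close>

lemma card_centralizer_outside_base:
  assumes t: "t \<in> carrier W" "fst t \<noteq> 0"
  shows "card {s \<in> carrier W. s \<otimes>\<^bsub>W\<^esub> t = t \<otimes>\<^bsub>W\<^esub> s} =
     p * card {u \<in> carrier G. u \<otimes> cycle_product t = cycle_product t \<otimes> u}"
proof -
  define C where "C j = {s \<in> carrier W. s \<otimes>\<^bsub>W\<^esub> t = t \<otimes>\<^bsub>W\<^esub> s \<and> fst s = j}" for j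
  have C0: "C 0 = base_centralizer t" by (auto simp: C_def base_centralizer_def)
  obtain d where d: "\<And>a. (int (nat ((a * d) mod int p)) * fst t) mod int p = a mod int p"
    using reach_by_shift[OF t] by blast
  have translate: "card (C j) = card (C 0)" if j: "j \<in> {0..<int p}" for j
  proof -
    define c where "c = t [^]\<^bsub>W\<^esub> nat ((j * d) mod int p)"
    have cW: "c \<in> carrier W" unfolding c_def by (rule W.nat_pow_closed[OF t(1)])
    have cj: "fst c = j" unfolding c_def fst_pow[OF t(1)] d using j by simp
    have ct: "t \<otimes>\<^bsub>W\<^esub> c = c \<otimes>\<^bsub>W\<^esub> t"
      unfolding c_def using t by (intro W.commutes_pow) simp_all
    have "bij_betw (\<lambda>s. c \<otimes>\<^bsub>W\<^esub> s) (C 0) (C j)"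
    proof (rule bij_betw_byWitness[where f' = "\<lambda>s. inv\<^bsub>W\<^esub> c \<otimes>\<^bsub>W\<^esub> s"])
      show "\<forall>s\<in>C 0. inv\<^bsub>W\<^esub> c \<otimes>\<^bsub>W\<^esub> (c \<otimes>\<^bsub>W\<^esub> s) = s"
        using cW by (auto simp: C_def simp flip: W.m_assoc)
      show *: "\<forall>s\<in>C j. c \<otimes>\<^bsub>W\<^esub> (inv\<^bsub>W\<^esub> c \<otimes>\<^bsub>W\<^esub> s) = s"
        using cW by (auto simp: C_def simp flip: W.m_assoc)
      show "(\<lambda>s. c \<otimes>\<^bsub>W\<^esub> s) ` C 0 \<subseteq> C j"
      proof
        fix s' assume "s' \<in> (\<lambda>s. c \<otimes>\<^bsub>W\<^esub> s) ` C 0"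
        then obtain s where s: "s \<in> C 0" "s' = c \<otimes>\<^bsub>W\<^esub> s" by blast
        then have sW: "s \<in> carrier W" "s \<otimes>\<^bsub>W\<^esub> t = t \<otimes>\<^bsub>W\<^esub> s" "fst s = 0" by (auto simp: C_def)
        have "c \<otimes>\<^bsub>W\<^esub> s \<otimes>\<^bsub>W\<^esub> t = t \<otimes>\<^bsub>W\<^esub> (c \<otimes>\<^bsub>W\<^esub> s)"
          using sW cW t ct by (metis W.m_assoc)
        then show "s' \<in> C j" using s sW cW cj j by (simp add: C_def fst_mult)
      qed
      show "(\<lambda>s. inv\<^bsub>W\<^esub> c \<otimes>\<^bsub>W\<^esub> s) ` C j \<subseteq> C 0"
      proof
        fix s' assume "s' \<in> (\<lambda>s. inv\<^bsub>W\<^esub> c \<otimes>\<^bsub>W\<^esub> s) ` C j"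
        then obtain s where s: "s \<in> C j" "s' = inv\<^bsub>W\<^esub> c \<otimes>\<^bsub>W\<^esub> s" by blast
        then have sW: "s \<in> carrier W" "s \<otimes>\<^bsub>W\<^esub> t = t \<otimes>\<^bsub>W\<^esub> s" "fst s = j" by (auto simp: C_def)
        have s'W: "s' \<in> carrier W" using s sW cW by simp
        have cs': "c \<otimes>\<^bsub>W\<^esub> s' = s" using * s by simp
        have "c \<otimes>\<^bsub>W\<^esub> (s' \<otimes>\<^bsub>W\<^esub> t) = c \<otimes>\<^bsub>W\<^esub> (t \<otimes>\<^bsub>W\<^esub> s')"
          using sW(2) cs' ct cW t s'W by (metis W.m_assoc)
        then have 1: "s' \<otimes>\<^bsub>W\<^esub> t = t \<otimes>\<^bsub>W\<^esub> s'" using cW t s'W by simp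
        have "(j + fst s') mod int p = fst (c \<otimes>\<^bsub>W\<^esub> s')" by (simp add: fst_mult cj)
        also have "\<dots> = j mod int p" using cs' sW(3) j by simp
        finally have "int p dvd fst s'" by (simp add: mod_eq_dvd_iff)
        then have "fst s' mod int p = 0" by simp
        then show "s' \<in> C 0" using 1 s'W by (simp add: C_def)
      qed
    qed
    then show ?thesis by (metis bij_betw_same_card)
  qed
  have "{s \<in> carrier W. s \<otimes>\<^bsub>W\<^esub> t = t \<otimes>\<^bsub>W\<^esub> s} = (\<Union>j\<in>{0..<int p}. C j)"
    by (auto simp: C_def mem_wreath_iff)
  then have "card {s \<in> carrier W. s \<otimes>\<^bsub>W\<^esub> t = t \<otimes>\<^bsub>W\<^esub> s} = card (\<Union>j\<in>{0..<int p}. C j)"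
    by (rule arg_cong)
  also have "\<dots> = (\<Sum>j\<in>{0..<int p}. card (C j))"
    by (rule card_UN_disjoint) (auto simp: C_def finite_wreath)
  also have "\<dots> = (\<Sum>j\<in>{0..<int p}. card (C 0))" by (intro sum.cong refl translate)
  also have "\<dots> = p * card (C 0)" by simp
  finally have "card {s \<in> carrier W. s \<otimes>\<^bsub>W\<^esub> t = t \<otimes>\<^bsub>W\<^esub> s} = p * card (C 0)" .
  then show ?thesis using bij_betw_same_card[OF bij_base_centralizer[OF t]] by (simp add: C0)
qed

section \<open>Counting commuting pairs in the wreath product\<close>

text \<open>Cycle products are equidistributed: multiplying the coordinate of \<open>t\<close> at one index by \<open>g\<close>
  permutes the elements outside the base and multiplies the cycle product by \<open>g\<close>.  Averaging over
  \<open>g\<close> turns the sum over elements \<open>t\<close> into sums over all of \<open>G\<close>.\<close>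

lemma sum_cycle_product:
  fixes f :: "'a \<Rightarrow> nat"
  shows "order G * (\<Sum>t\<in>{t \<in> carrier W. fst t \<noteq> 0}. f (cycle_product t)) =
     (p - 1) * order G ^ p * (\<Sum>z\<in>carrier G. f z)"
proof -
  let ?F = "{t \<in> carrier W. fst t \<noteq> 0}"
  \<comment> \<open>Left multiplication by \<open>\<delta> g\<close> changes the coordinate of \<open>t\<close> at index \<open>- fst t\<close>, the last factor
    to be met on the cycle from \<open>0\<close>; this is why \<open>g\<close> appears on the left of the product.\<close>
  define \<delta> where "\<delta> g = (0::int, \<lambda>a. if int p dvd a then g else \<one>)" for g
  have \<delta>W: "\<delta> g \<in> carrier W" if "g \<in> carrier G" for g
    using that p_pos by (auto simp: \<delta>_def mem_wreath_iff)
  have \<delta>_snd: "snd (\<delta> g) a = (if int p dvd a then g else \<one>)" for g a by (simp add: \<delta>_def)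
  have ft: "fst (\<delta> g \<otimes>\<^bsub>W\<^esub> t) = fst t" if "t \<in> carrier W" for g t
    using that by (simp add: fst_mult \<delta>_def)
  have cp: "cycle_product (\<delta> g \<otimes>\<^bsub>W\<^esub> t) = g \<otimes> cycle_product t"
    if g: "g \<in> carrier G" and t: "t \<in> ?F" for g t
  proof -
    let ?t = "\<delta> g \<otimes>\<^bsub>W\<^esub> t"
    have tW: "t \<in> carrier W" "?t \<in> carrier W" using g t \<delta>W by auto
    have ndvd: "\<not> int p dvd fst t" using t by (auto simp: mem_wreath_iff dest: zdvd_imp_le)
    have step: "snd (?t [^]\<^bsub>W\<^esub> Suc m) 0 =
      (if p dvd Suc m then g else \<one>) \<otimes> snd t (int m * fst t) \<otimes> snd (?t [^]\<^bsub>W\<^esub> m) 0" for m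
    proof -
      have "int m * fst t + fst t = int (Suc m) * fst t" by (simp add: algebra_simps)
      moreover have "int p dvd int (Suc m) * fst t \<longleftrightarrow> p dvd Suc m"
        using ndvd prime_p by (metis int_dvd_int_iff prime_dvd_mult_iff prime_nat_int_transfer)
      ultimately show ?thesis
        unfolding snd_pow_Suc[OF tW(2)] by (simp add: ft tW snd_mult \<delta>_snd)
    qed
    have below: "snd (?t [^]\<^bsub>W\<^esub> m) 0 = snd (t [^]\<^bsub>W\<^esub> m) 0" if "m < p" for m
      using that
    proof (induction m)
      case (Suc m)
      then have "\<not> p dvd Suc m" by (auto dest: dvd_imp_le)
      then show ?case using Suc tW by (simp only: step snd_pow_Suc[OF tW(1)]) simp
    qed simp
    have e: "Suc (p - 1) = p" using p_pos by simp
    have "snd (?t [^]\<^bsub>W\<^esub> p) 0 = g \<otimes> snd t (int (p - 1) * fst t) \<otimes> snd (t [^]\<^bsub>W\<^esub> (p - 1)) 0"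
      using step[of "p - 1"] below[of "p - 1"] p_pos by (simp only: e) simp
    moreover have "snd (t [^]\<^bsub>W\<^esub> p) 0 = snd t (int (p - 1) * fst t) \<otimes> snd (t [^]\<^bsub>W\<^esub> (p - 1)) 0"
      using snd_pow_Suc[OF tW(1), of "p - 1" 0] by (simp only: e) simp
    ultimately show ?thesis using g tW by (simp add: cycle_product_def m_assoc)
  qed
  have perm: "(\<Sum>t\<in>?F. f (g \<otimes> cycle_product t)) = (\<Sum>t\<in>?F. f (cycle_product t))"
    if g: "g \<in> carrier G" for g
  proof -
    have inj: "inj_on (\<lambda>t. \<delta> g \<otimes>\<^bsub>W\<^esub> t) ?F" using \<delta>W[OF g] by (auto intro: inj_onI)
    have "(\<lambda>t. \<delta> g \<otimes>\<^bsub>W\<^esub> t) ` ?F \<subseteq> ?F" using \<delta>W[OF g] by (intro image_subsetI) (simp add: ft)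
    then have "(\<lambda>t. \<delta> g \<otimes>\<^bsub>W\<^esub> t) ` ?F = ?F"
      using finite_wreath by (intro endo_inj_surj inj) simp_all
    then have "bij_betw (\<lambda>t. \<delta> g \<otimes>\<^bsub>W\<^esub> t) ?F ?F" using inj by (simp add: bij_betw_def)
    then have "(\<Sum>t\<in>?F. f (cycle_product (\<delta> g \<otimes>\<^bsub>W\<^esub> t))) = (\<Sum>t\<in>?F. f (cycle_product t))"
      by (rule sum.reindex_bij_betw)
    then show ?thesis using cp[OF g] by simp
  qed
  have translate: "(\<Sum>g\<in>carrier G. f (g \<otimes> z)) = (\<Sum>g\<in>carrier G. f g)" if z: "z \<in> carrier G" for z
  proof -
    have inj: "inj_on (\<lambda>g. g \<otimes> z) (carrier G)" using z by (auto intro: inj_onI)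
    then have "(\<lambda>g. g \<otimes> z) ` carrier G = carrier G"
      using fin z by (intro endo_inj_surj) auto
    then have "bij_betw (\<lambda>g. g \<otimes> z) (carrier G) (carrier G)" using inj by (simp add: bij_betw_def)
    then show ?thesis by (rule sum.reindex_bij_betw)
  qed
  have "order G * (\<Sum>t\<in>?F. f (cycle_product t)) =
    (\<Sum>g\<in>carrier G. \<Sum>t\<in>?F. f (g \<otimes> cycle_product t))"
    by (simp add: perm order_def)
  also have "\<dots> = (\<Sum>t\<in>?F. \<Sum>g\<in>carrier G. f (g \<otimes> cycle_product t))" by (rule sum.swap)
  also have "\<dots> = card ?F * (\<Sum>g\<in>carrier G. f g)" by (simp add: translate)
  finally show ?thesis by (simp only: card_fst_nonzero)
qed

text \<open>In the base everything happens coordinatewise, so a commuting pair of functions is a function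
  into commuting pairs.\<close>

lemma card_commuting_pairs_base:
  "card {(s, t) \<in> commuting_pairs W q. fst s = 0 \<and> fst t = 0} = card (commuting_pairs G q) ^ p"
proof -
  let ?A = "{(s, t) \<in> commuting_pairs W q. fst s = 0 \<and> fst t = 0}"
  let ?f = "\<lambda>(s :: int \<times> (int \<Rightarrow> 'a), t :: int \<times> (int \<Rightarrow> 'a)) a. (snd s a, snd t a)"
  have "bij_betw ?f ?A (periodic_functions p (commuting_pairs G q))"
  proof (rule bij_betw_byWitness[where f' = "\<lambda>h. ((0, fst \<circ> h), (0, snd \<circ> h))"])
    show "\<forall>st\<in>?A. ((0, fst \<circ> ?f st), (0, snd \<circ> ?f st)) = st"
      by (auto simp: comp_def)
    show "?f ` ?A \<subseteq> periodic_functions p (commuting_pairs G q)"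
      by (auto simp: commuting_pairs_def periodic_functions_def mem_wreath_iff base_pow one_wreath
        prod_eq_iff fst_mult snd_mult fun_eq_iff)
    show "(\<lambda>h. ((0, fst \<circ> h), (0, snd \<circ> h))) ` periodic_functions p (commuting_pairs G q) \<subseteq> ?A"
    proof clarify
      fix h assume h: "h \<in> periodic_functions p (commuting_pairs G q)"
      have "h a \<in> commuting_pairs G q" "h (a + int p) = h a" for a
        using h by (auto simp: periodic_functions_def)
      then have *: "fst (h a) \<in> carrier G" "snd (h a) \<in> carrier G"
        "fst (h a) \<otimes> snd (h a) = snd (h a) \<otimes> fst (h a)" "fst (h a) [^] q = \<one>"
        "h (a + int p) = h a" for a
        by (auto simp: commuting_pairs_def case_prod_beta)
      then have "(0, fst \<circ> h) \<in> carrier W" "(0, snd \<circ> h) \<in> carrier W"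
        using p_pos by (auto simp: mem_wreath_iff)
      then show "((0, fst \<circ> h), (0, snd \<circ> h)) \<in> commuting_pairs W q \<and>
        fst (0::int, fst \<circ> h) = 0 \<and> fst (0::int, snd \<circ> h) = 0"
        using * by (simp add: commuting_pairs_def base_pow one_wreath
          prod_eq_iff fst_mult snd_mult fun_eq_iff)
    qed
  qed auto
  then have "card ?A = card (periodic_functions p (commuting_pairs G q))"
    by (rule bij_betw_same_card)
  then show ?thesis using p_pos by (simp add: card_periodic_functions)
qed

lemma card_commuting_pairs_outside_base:
  "order G * card {(s, t) \<in> commuting_pairs W q. fst s = 0 \<and> fst t \<noteq> 0} =
     (p - 1) * order G ^ p * card (commuting_pairs G q)"
proof -
  let ?F = "{t \<in> carrier W. fst t \<noteq> 0}"
  let ?f = "\<lambda>z. card {u \<in> carrier G. u \<otimes> z = z \<otimes> u \<and> u [^] q = \<one>}"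
  let ?B = "\<lambda>t. {s \<in> base_centralizer t. s [^]\<^bsub>W\<^esub> q = \<one>\<^bsub>W\<^esub>}"
  have card_B: "card (?B t) = ?f (cycle_product t)" if "t \<in> ?F" for t
  proof -
    have t: "t \<in> carrier W" "fst t \<noteq> 0" using that by auto
    have img: "(\<lambda>s. snd s 0) ` base_centralizer t
      = {u \<in> carrier G. u \<otimes> cycle_product t = cycle_product t \<otimes> u}"
      and inj: "inj_on (\<lambda>s. snd s 0) (base_centralizer t)"
      using bij_base_centralizer[OF t] by (simp_all add: bij_betw_def)
    have "?B t = {s \<in> base_centralizer t. snd s 0 [^] q = \<one>}"
      using base_pow_eq_one_iff[OF t] by blast
    then have "(\<lambda>s. snd s 0) ` ?B t = {u \<in> (\<lambda>s. snd s 0) ` base_centralizer t. u [^] q = \<one>}"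
      by auto
    also have "\<dots> = {u \<in> carrier G. u \<otimes> cycle_product t = cycle_product t \<otimes> u \<and> u [^] q = \<one>}"
      unfolding img by auto
    finally show ?thesis
      using card_image[OF inj_on_subset[OF inj], of "?B t"] by auto
  qed
  have "{(s, t) \<in> commuting_pairs W q. fst s = 0 \<and> fst t \<noteq> 0}
    = prod.swap ` {(t, s). t \<in> ?F \<and> s \<in> ?B t}"
    by (auto simp: commuting_pairs_def base_centralizer_def)
  then have "card {(s, t) \<in> commuting_pairs W q. fst s = 0 \<and> fst t \<noteq> 0}
    = card {(t, s). t \<in> ?F \<and> s \<in> ?B t}" by (simp add: card_image)
  also have "\<dots> = (\<Sum>t\<in>?F. card (?B t))"
    by (rule card_pairs) (auto simp: finite_wreath base_centralizer_def)
  also have "\<dots> = (\<Sum>t\<in>?F. ?f (cycle_product t))"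
    by (intro sum.cong refl card_B)
  finally have "order G * card {(s, t) \<in> commuting_pairs W q. fst s = 0 \<and> fst t \<noteq> 0}
    = (p - 1) * order G ^ p * (\<Sum>z\<in>carrier G. ?f z)"
    by (simp only: sum_cycle_product[of ?f])
  also have "(\<Sum>z\<in>carrier G. ?f z) =
    card {(z, u). z \<in> carrier G \<and> u \<in> {u \<in> carrier G. u \<otimes> z = z \<otimes> u \<and> u [^] q = \<one>}}"
    by (rule card_pairs[symmetric]) (auto simp: fin)
  also have "\<dots> = card (prod.swap ` commuting_pairs G q)"
    by (rule arg_cong[where f = card]) (auto simp: commuting_pairs_def image_iff)
  also have "\<dots> = card (commuting_pairs G q)" by (simp add: card_image)
  finally show ?thesis .
qed

lemma card_commuting_pairs_first_outside_base:
  "order G * card {(s, t) \<in> commuting_pairs W (p * r). fst s \<noteq> 0} =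
     (p - 1) * order G ^ p * (p * card (commuting_pairs G r))"
proof -
  let ?F = "{t \<in> carrier W. fst t \<noteq> 0}"
  let ?C = "\<lambda>z. {u \<in> carrier G. u \<otimes> z = z \<otimes> u \<and> z [^] r = \<one>}"
  let ?B = "\<lambda>s. {t \<in> carrier W. t \<otimes>\<^bsub>W\<^esub> s = s \<otimes>\<^bsub>W\<^esub> t \<and> s [^]\<^bsub>W\<^esub> (p * r) = \<one>\<^bsub>W\<^esub>}"
  have card_B: "card (?B s) = p * card (?C (cycle_product s))" if "s \<in> ?F" for s
    using that card_centralizer_outside_base[of s] pow_eq_one_iff_cycle_product[of s r]
    by (cases "cycle_product s [^] r = \<one>") auto
  have "{(s, t) \<in> commuting_pairs W (p * r). fst s \<noteq> 0} = {(s, t). s \<in> ?F \<and> t \<in> ?B s}"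
    by (auto simp: commuting_pairs_def)
  also have "card \<dots> = (\<Sum>s\<in>?F. card (?B s))"
    by (rule card_pairs) (auto simp: finite_wreath)
  also have "\<dots> = (\<Sum>s\<in>?F. p * card (?C (cycle_product s)))"
    by (intro sum.cong refl card_B)
  finally have "order G * card {(s, t) \<in> commuting_pairs W (p * r). fst s \<noteq> 0}
    = (p - 1) * order G ^ p * (\<Sum>z\<in>carrier G. p * card (?C z))"
    by (simp only: sum_cycle_product[of "\<lambda>z. p * card (?C z)"])
  also have "(\<Sum>z\<in>carrier G. p * card (?C z)) = p * (\<Sum>z\<in>carrier G. card (?C z))"
    by (simp add: sum_distrib_left)
  also have "(\<Sum>z\<in>carrier G. card (?C z)) = card {(z, u). z \<in> carrier G \<and> u \<in> ?C z}"
    by (rule card_pairs[symmetric]) (auto simp: fin)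
  also have "{(z, u). z \<in> carrier G \<and> u \<in> ?C z} = commuting_pairs G r"
    by (auto simp: commuting_pairs_def)
  finally show ?thesis .
qed

text \<open>The commuting pairs \<open>(s, t)\<close> are split according to whether both lie in the base, only \<open>s\<close> does,
  or \<open>s\<close> does not.  In the last case \<open>s\<close> is killed by \<open>p * r\<close> if and only if its cycle product is
  killed by \<open>r\<close>, which produces the term with the smaller exponent.\<close>

theorem torsion_class_count_wreath:
  "p * torsion_class_count W (p * r) =
     torsion_class_count G (p * r) ^ p + (p - 1) * torsion_class_count G (p * r)
     + (p - 1) * p * torsion_class_count G r"
proof -
  let ?h = "torsion_class_count G (p * r)" and ?o = "order G"
  let ?P = "commuting_pairs W (p * r)"
  have fP: "finite ?P"
    by (rule finite_subset[of _ "carrier W \<times> carrier W"]) (auto simp: commuting_pairs_def finite_wreath)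
  let ?A = "{(s, t) \<in> ?P. fst s = 0 \<and> fst t = 0}"
  let ?B = "{(s, t) \<in> ?P. fst s = 0 \<and> fst t \<noteq> 0}"
  let ?C = "{(s, t) \<in> ?P. fst s \<noteq> 0}"
  have fA: "finite ?A" and fB: "finite ?B" and fC: "finite ?C"
    by (rule finite_subset[OF _ fP]; auto)+
  have "?P = ?A \<union> (?B \<union> ?C)" by auto
  then have "card ?P = card (?A \<union> (?B \<union> ?C))" by simp
  also have "\<dots> = card ?A + card (?B \<union> ?C)"
    using fA fB fC by (intro card_Un_disjoint) auto
  also have "card (?B \<union> ?C) = card ?B + card ?C"
    using fB fC by (intro card_Un_disjoint) auto
  finally have "?o * card ?P = ?o * card ?A + ?o * card ?B + ?o * card ?C"
    by (simp add: algebra_simps)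
  then have "?o * (p * ?o ^ p * torsion_class_count W (p * r)) =
    ?o * (?o * ?h) ^ p + (p - 1) * ?o ^ p * (?o * ?h)
    + (p - 1) * ?o ^ p * (p * (?o * torsion_class_count G r))"
    unfolding card_commuting_pairs_base card_commuting_pairs_outside_base
      card_commuting_pairs_first_outside_base W.card_commuting_pairs[OF finite_wreath]
      card_commuting_pairs[OF fin] order_wreath .
  then have "(?o * ?o ^ p) * (p * torsion_class_count W (p * r)) =
    (?o * ?o ^ p) * (?h ^ p + (p - 1) * ?h + (p - 1) * p * torsion_class_count G r)"
    unfolding power_mult_distrib distrib_left by (simp only: mult.assoc mult.commute mult.left_commute)
  moreover have "?o \<noteq> 0" using fin order_gt_0_iff_finite by simp
  ultimately show ?thesis by simp
qed

end

section \<open>Sylow subgroups of symmetric groups\<close>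

lemma action_embeds_in_sym_group:
  assumes "group G" and fin: "finite E" "card E = N"
    and closed: "\<And>g x. g \<in> carrier G \<Longrightarrow> x \<in> E \<Longrightarrow> f g x \<in> E"
    and one: "\<And>x. x \<in> E \<Longrightarrow> f \<one>\<^bsub>G\<^esub> x = x"
    and mult: "\<And>g h x. g \<in> carrier G \<Longrightarrow> h \<in> carrier G \<Longrightarrow> x \<in> E \<Longrightarrow>
      f (g \<otimes>\<^bsub>G\<^esub> h) x = f g (f h x)"
    and faithful: "\<And>g h. g \<in> carrier G \<Longrightarrow> h \<in> carrier G \<Longrightarrow>
      (\<And>x. x \<in> E \<Longrightarrow> f g x = f h x) \<Longrightarrow> g = h"
  obtains F where "F \<in> hom G (sym_group N)" "inj_on F (carrier G)"
proof -
  interpret group G by fact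
  obtain e where e: "bij_betw e E {1..N}"
    using finite_same_card_bij[OF fin(1), of "{1..N}"] fin(2) by auto
  define d where "d = inv_into E e"
  have de: "d (e x) = x" "e x \<in> {1..N}" if "x \<in> E" for x
    using e that by (auto simp: d_def bij_betw_def)
  have ed: "e (d v) = v" "d v \<in> E" if "v \<in> {1..N}" for v
    using e that by (auto simp: d_def bij_betw_def f_inv_into_f inv_into_into)
  define F where "F g v = (if v \<in> {1..N} then e (f g (d v)) else v)" for g v
  have F_in: "F g v \<in> {1..N}" if "g \<in> carrier G" "v \<in> {1..N}" for g v
    using that de(2)[OF closed[OF that(1) ed(2)[OF that(2)]]] by (simp add: F_def)
  have F_mult: "F (g \<otimes>\<^bsub>G\<^esub> h) = F g \<circ> F h" if g: "g \<in> carrier G" and h: "h \<in> carrier G" for g h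
  proof
    fix v
    show "F (g \<otimes>\<^bsub>G\<^esub> h) v = (F g \<circ> F h) v"
    proof (cases "v \<in> {1..N}")
      case True
      have "F g (F h v) = e (f g (d (F h v)))" using F_in[OF h True] by (simp add: F_def[of g])
      also have "d (F h v) = f h (d v)"
        using True h by (simp add: F_def de closed ed del: atLeastAtMost_iff)
      finally have "F g (F h v) = e (f g (f h (d v)))" .
      moreover have "F (g \<otimes>\<^bsub>G\<^esub> h) v = e (f g (f h (d v)))"
        using True g h by (simp add: F_def mult ed del: atLeastAtMost_iff)
      ultimately show ?thesis by simp
    qed (simp add: F_def del: atLeastAtMost_iff)
  qed
  have F_one: "F \<one>\<^bsub>G\<^esub> = id" by (auto simp: F_def fun_eq_iff one ed simp del: atLeastAtMost_iff)
  have F_perm: "F g permutes {1..N}" if g: "g \<in> carrier G" for g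
  proof (rule bij_imp_permutes)
    have "F (inv\<^bsub>G\<^esub> g) (F g v) = v" "F g (F (inv\<^bsub>G\<^esub> g) v) = v" for v
      using F_mult[of "inv\<^bsub>G\<^esub> g" g] F_mult[of g "inv\<^bsub>G\<^esub> g"] g F_one by (simp_all add: fun_eq_iff)
    then show "bij_betw (F g) {1..N} {1..N}"
      using F_in g by (intro bij_betw_byWitness[where f' = "F (inv\<^bsub>G\<^esub> g)"]) blast+
  qed (auto simp: F_def)
  have "F \<in> hom G (sym_group N)"
    by (rule homI) (simp_all only: sym_group_carrier sym_group_mult F_perm F_mult)
  moreover have "inj_on F (carrier G)"
  proof (rule inj_onI)
    fix g h assume g: "g \<in> carrier G" and h: "h \<in> carrier G" and eq: "F g = F h"
    show "g = h"
    proof (rule faithful[OF g h])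
      fix x assume x: "x \<in> E"
      have "F g (e x) = F h (e x)" using eq by simp
      then have "e (f g x) = e (f h x)" using x de by (simp add: F_def del: atLeastAtMost_iff)
      then show "f g x = f h x" using x g h closed de(1) by metis
    qed
  qed
  ultimately show thesis by (rule that)
qed

text \<open>This is the action on \<open>p\<close> copies of \<open>{1..m}\<close> that the multiplication of \<open>wreath\<close> is
  modelled on.\<close>

lemma wreath_embeds_in_sym_group:
  assumes p: "Factorial_Ring.prime p" and "m > 0" and H: "subgroup H (sym_group m)"
  obtains F where "F \<in> hom (wreath ((sym_group m)\<lparr>carrier := H\<rparr>) p) (sym_group (p * m))"
    "inj_on F (carrier (wreath ((sym_group m)\<lparr>carrier := H\<rparr>) p))"
proof -
  let ?G = "(sym_group m)\<lparr>carrier := H\<rparr>"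
  have perm: "h permutes {1..m}" if "h \<in> H" for h
    using subgroup.mem_carrier[OF H that] by (simp add: sym_group_carrier)
  have "finite H" using H finite_permutations[of "{1..m}"]
    by (auto intro: finite_subset dest!: subgroup.subset simp: sym_group_def)
  interpret G: group ?G using group.subgroup_imp_group[OF sym_group_is_group H] .
  interpret prime_wreath ?G p by unfold_locales (simp_all add: p \<open>finite H\<close>)
  let ?f = "\<lambda>t (a, v). ((a + fst t) mod int p, snd t a v)"
  let ?E = "{0..<int p} \<times> {1..m}"
  have in_H: "snd t a \<in> H" if "t \<in> carrier W" for t a using snd_closed[OF that] by simp
  show thesis
  proof (rule action_embeds_in_sym_group[of W ?E "p * m" ?f])
    show "card ?E = p * m" by (simp add: card_cartesian_product)
    show "?f t x \<in> ?E" if "t \<in> carrier W" "x \<in> ?E" for t x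
      using that p_pos permutes_in_image[OF perm[OF in_H[OF that(1)]]]
      by (cases x) (auto simp del: atLeastAtMost_iff)
    show "?f \<one>\<^bsub>W\<^esub> x = x" if "x \<in> ?E" for x
      using that by (cases x) (simp add: one_wreath sym_group_one)
    show "?f (s \<otimes>\<^bsub>W\<^esub> t) x = ?f s (?f t x)"
      if st: "s \<in> carrier W" "t \<in> carrier W" and "x \<in> ?E" for s t x
    proof -
      have "snd s ((a + fst t) mod int p) = snd s (a + fst t)" for a
        by (rule snd_cong[OF st(1)]) simp
      moreover have "(a + (fst s + fst t) mod int p) mod int p
          = ((a + fst t) mod int p + fst s) mod int p" for a
        by (simp add: mod_simps add.assoc add.commute add.left_commute)
      ultimately show ?thesis
        by (cases x) (simp add: fst_mult snd_mult sym_group_mult)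
    qed
    show "s = t" if st: "s \<in> carrier W" "t \<in> carrier W" and eq: "\<And>x. x \<in> ?E \<Longrightarrow> ?f s x = ?f t x" for s t
    proof (rule prod_eqI)
      have *: "(a + fst s) mod int p = (a + fst t) mod int p" "snd s a v = snd t a v"
        if "a \<in> {0..<int p}" "v \<in> {1..m}" for a v
        using eq[of "(a, v)"] that by auto
      show "fst s = fst t" using *(1)[of 0 1] st p_pos \<open>m > 0\<close> by simp
      show "snd s = snd t"
      proof
        fix a
        have "snd s (a mod int p) v = snd t (a mod int p) v" for v
        proof (cases "v \<in> {1..m}")
          case True then show ?thesis using *(2)[of "a mod int p" v] p_pos by simp
        next
          case False then show ?thesis
            using permutes_not_in[OF perm[OF in_H]] st by metis
        qed
        moreover have "snd s (a mod int p) = snd s a" "snd t (a mod int p) = snd t a"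
          using st by (auto intro: snd_cong)
        ultimately show "snd s a = snd t a" by auto
      qed
    qed
  qed (auto simp: group_wreath that)
qed

text \<open>Of the factors of \<open>(p m)!\<close> only the multiples \<open>p\<close>, \<open>2 p\<close>, and so on up to \<open>m p\<close> count; they
  contribute \<open>m\<close> factors \<open>p\<close> and the multiplicity of \<open>p\<close> in \<open>m!\<close>.\<close>

lemma multiplicity_fact_prime_mult:
  fixes p :: nat
  assumes "Factorial_Ring.prime p"
  shows "multiplicity p (fact (p * m) :: nat) = m + multiplicity p (fact m :: nat)"
proof (induction m)
  case (Suc m)
  have p: "p > 0" using assms by (rule prime_gt_0_nat)
  have "multiplicity p (\<Prod>i\<in>{Suc (p * m)..<p * Suc m}. i) = 0"
  proof -
    have "\<not> p dvd i" if "i \<in> {Suc (p * m)..<p * Suc m}" for i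
    proof
      assume "p dvd i"
      then obtain k where "i = p * k" by blast
      then have "p * m < p * k" "p * k < p * Suc m" using that by (auto simp only: atLeastLessThan_iff Suc_le_eq)
      then have "m < k" "k < Suc m" using mult_less_cancel1 by blast+
      then show False by simp
    qed
    then have "\<not> p dvd (\<Prod>i\<in>{Suc (p * m)..<p * Suc m}. i)"
      using assms by (simp add: prime_dvd_prod_iff)
    then show ?thesis by (rule not_dvd_imp_multiplicity_0)
  qed
  moreover have "(fact (p * Suc m) :: nat)
     = fact (p * m) * ((\<Prod>i\<in>{Suc (p * m)..<p * Suc m}. i) * (p * Suc m))"
  proof -
    have "{1..p * Suc m} = {1..p * m} \<union> insert (p * Suc m) {Suc (p * m)..<p * Suc m}"
      using p by auto
    then have "\<Prod>{1..p * Suc m} = \<Prod>{1..p * m} * \<Prod>(insert (p * Suc m) {Suc (p * m)..<p * Suc m})"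
      using p by (simp only:) (subst prod.union_disjoint, auto)
    then show ?thesis by (simp add: fact_prod mult.assoc mult.commute mult.left_commute del: mult_Suc mult_Suc_right)
  qed
  moreover have "(\<Prod>i\<in>{Suc (p * m)..<p * Suc m}. i) \<noteq> 0" by (simp add: prod_zero_iff)
  ultimately have "multiplicity p (fact (p * Suc m) :: nat)
     = multiplicity p (fact (p * m) :: nat) + (multiplicity p p + multiplicity p (Suc m))"
    using assms p by (simp add: prime_elem_multiplicity_mult_distrib del: mult_Suc_right fact_Suc)
  then show ?case using Suc assms p
    by (simp add: prime_elem_multiplicity_mult_distrib del: mult_Suc mult_Suc_right)
qed simp

text \<open>The order of a Sylow \<open>p\<close>-subgroup of the symmetric group on \<open>p ^ n\<close> points is \<open>p\<close> to this
  power.\<close>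

definition sylow_exponent :: "nat \<Rightarrow> nat \<Rightarrow> nat" where
  "sylow_exponent p n = (\<Sum>i<n. p ^ i)"

lemma sylow_exponent_Suc: "sylow_exponent p (Suc n) = p * sylow_exponent p n + 1"
  by (simp add: sylow_exponent_def sum.lessThan_Suc_shift sum_distrib_left del: sum.lessThan_Suc)

lemma real_sylow_exponent:
  "p \<ge> 2 \<Longrightarrow> real (sylow_exponent p n) = (real p ^ n - 1) / (real p - 1)"
  by (simp add: sylow_exponent_def sum_gp_strict field_simps)

lemma multiplicity_fact_prime_power:
  assumes "Factorial_Ring.prime p"
  shows "multiplicity p (fact (p ^ n) :: nat) = sylow_exponent p n"
  by (induction n) (simp_all add: sylow_exponent_def multiplicity_fact_prime_mult assms)

lemma order_sym_group: "order (sym_group m) = fact m"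
  by (simp add: order_def sym_group_def card_permutations)

lemma is_sylow_subgroup_sym_group_iff:
  assumes "Factorial_Ring.prime p"
  shows "is_sylow_subgroup p (sym_group (p ^ n)) H \<longleftrightarrow>
     subgroup H (sym_group (p ^ n)) \<and> card H = p ^ sylow_exponent p n"
proof -
  have "finite (carrier (sym_group (p ^ n)))" by (simp add: sym_group_def finite_permutations)
  then show ?thesis
    by (simp add: is_sylow_subgroup_def order_sym_group multiplicity_fact_prime_power assms)
qed

text \<open>The embedded wreath product has the order of a Sylow subgroup by \<open>sylow_exponent_Suc\<close>, hence it
  is conjugate to \<open>K\<close>.\<close>

theorem sylow_sym_group_iso_wreath:
  assumes p: "Factorial_Ring.prime p"
    and H: "is_sylow_subgroup p (sym_group (p ^ n)) H"
    and K: "is_sylow_subgroup p (sym_group (p ^ Suc n)) K"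
  obtains h where
    "h \<in> iso (wreath ((sym_group (p ^ n))\<lparr>carrier := H\<rparr>) p) ((sym_group (p ^ Suc n))\<lparr>carrier := K\<rparr>)"
proof -
  let ?G = "(sym_group (p ^ n))\<lparr>carrier := H\<rparr>" and ?S = "sym_group (p ^ Suc n)"
  have sub: "subgroup H (sym_group (p ^ n))" and card: "card H = p ^ sylow_exponent p n"
    using H by (simp_all add: is_sylow_subgroup_sym_group_iff p)
  have p_pos: "p > 0" using p by (rule prime_gt_0_nat)
  interpret G: group ?G using group.subgroup_imp_group[OF sym_group_is_group sub] .
  have "finite H" using card p_pos by (intro card_ge_0_finite) simp
  interpret prime_wreath ?G p by unfold_locales (simp_all add: p \<open>finite H\<close>)
  obtain F where F: "F \<in> hom W ?S" "inj_on F (carrier W)"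
    using wreath_embeds_in_sym_group[OF p _ sub] p_pos by auto
  interpret F: group_hom W ?S F
    using F(1) group_wreath sym_group_is_group by (simp add: group_hom_def group_hom_axioms_def)
  let ?I = "F ` carrier W"
  have "card ?I = order W" using F(2) by (simp add: card_image order_def)
  also have "\<dots> = p ^ sylow_exponent p (Suc n)"
    unfolding order_wreath by (simp add: order_def card sylow_exponent_Suc power_mult[symmetric] mult.commute)
  finally have "is_sylow_subgroup p ?S ?I"
    unfolding is_sylow_subgroup_sym_group_iff[OF p] using F.img_is_subgroup by simp
  then obtain h where h: "h \<in> iso (?S\<lparr>carrier := ?I\<rparr>) (?S\<lparr>carrier := K\<rparr>)"
    using group.sylow_subgroups_isomorphic[OF sym_group_is_group p K] by blast
  have "F \<in> iso W (?S\<lparr>carrier := ?I\<rparr>)"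
    using F by (auto simp: iso_def hom_def bij_betw_def)
  then have "h \<circ> F \<in> iso W (?S\<lparr>carrier := K\<rparr>)"
    using h by (rule iso_set_trans)
  then show thesis by (rule that)
qed

section \<open>Growth of the class numbers\<close>

text \<open>The number of all conjugacy classes of \<open>P\<^sub>n\<close>, as a sequence depending on \<open>p\<close> alone; this makes
  \<open>\<gamma>\<close> independent of the choice of the Sylow subgroups.  The index \<open>0\<close> stands for the trivial
  group.\<close>

primrec total_classes :: "nat \<Rightarrow> nat \<Rightarrow> real" where
  "total_classes p 0 = 1"
| "total_classes p (Suc n) =
     (total_classes p n ^ p + (real p ^ 2 - 1) * total_classes p n) / real p"

declare total_classes.simps(2) [simp del]

lemma total_classes_1: "p > 0 \<Longrightarrow> total_classes p 1 = real p"
  by (simp add: total_classes.simps(2) power2_eq_square)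

lemma total_classes_ge:
  assumes "p \<ge> 2"
  shows "total_classes p (Suc n) \<ge> real p"
proof (induction n)
  case 0
  then show ?case using total_classes_1[of p] assms by simp
next
  case (Suc n)
  let ?a = "total_classes p (Suc n)"
  have a: "?a \<ge> real p" by fact
  have "real p * 2 \<le> real p ^ 2" using assms by (simp add: power2_eq_square)
  then have "real p \<le> real p ^ 2 - 1" using assms by linarith
  then have "real p * ?a \<le> (real p ^ 2 - 1) * ?a" using a by (intro mult_right_mono) auto
  then have "real p * ?a \<le> ?a ^ p + (real p ^ 2 - 1) * ?a" using a by (simp add: add_increasing)
  then have "?a \<le> total_classes p (Suc (Suc n))"
    using assms by (simp only: total_classes.simps(2)[of p "Suc n"]) (simp add: field_simps)
  then show ?case using a by linarith
qed

text \<open>In the coordinate \<open>(ln x - ln p / (p - 1)) / p ^ n\<close> at time \<open>n\<close> the recursion \<open>x \<mapsto> x ^ p / p\<close>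
  becomes constant.  There \<open>A\<close> increases, \<open>B\<close> strictly decreases and \<open>A\<close> stays below \<open>B\<close>; the
  supremum \<open>c\<close> of the values of \<open>A\<close> therefore separates the two.\<close>

lemma power_recursion_sandwich:
  fixes A B :: "nat \<Rightarrow> real" and p :: nat
  assumes p: "p \<ge> 2" and A: "\<And>n. 0 < A n" and AB: "\<And>n. A n \<le> B n"
    and A_step: "\<And>n. A n ^ p / real p \<le> A (Suc n)"
    and B_step: "\<And>n. B (Suc n) < B n ^ p / real p"
  obtains c where "\<And>n. A n \<le> exp (ln (real p) / (real p - 1) + c * real p ^ n)"
    "\<And>n. exp (ln (real p) / (real p - 1) + c * real p ^ n) < B n"
proof -
  let ?K = "ln (real p) / (real p - 1)"
  define L where "L n x = (ln x - ?K) / real p ^ n" for n and x :: real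
  have K: "real p * ?K = ?K + ln (real p)" using p by (simp add: field_simps)
  have L_step: "L (Suc n) (x ^ p / real p) = L n x" if "x > 0" for n x
  proof -
    have "ln (x ^ p / real p) - ?K = real p * (ln x - ?K)"
      using that p K by (simp add: ln_div ln_realpow algebra_simps)
    then show ?thesis using p by (simp add: L_def)
  qed
  have L_mono: "L n x \<le> L n y" if "0 < x" "x \<le> y" for n x y
    using that p unfolding L_def by (intro divide_right_mono) auto
  have L_strict: "L n x < L n y" if "0 < x" "x < y" for n x y
    using that p unfolding L_def by (intro divide_strict_right_mono) auto
  have B: "0 < B n" for n using A[of n] AB[of n] by linarith
  define lo where "lo n = L n (A n)" for n
  define hi where "hi n = L n (B n)" for n
  have "incseq lo"
  proof (rule incseq_SucI)
    show "lo n \<le> lo (Suc n)" for n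
      using L_mono[OF _ A_step, of n "Suc n"] L_step[OF A, of n n] A[of n] p by (simp add: lo_def)
  qed
  have hi_step: "hi (Suc n) < hi n" for n
    using L_strict[OF B B_step, of "Suc n" n] L_step[OF B, of n n] by (simp add: hi_def)
  then have "decseq hi" by (intro decseq_SucI less_imp_le)
  have "lo n \<le> hi n" for n using L_mono[OF A AB] by (simp add: lo_def hi_def)
  then have lo_hi: "lo m \<le> hi n" for m n
    using incseqD[OF \<open>incseq lo\<close>, of m "max m n"] decseqD[OF \<open>decseq hi\<close>, of n "max m n"]
    by (meson max.cobounded1 max.cobounded2 order_trans)
  then have bdd: "bdd_above (range lo)" by (intro bdd_aboveI[of _ "hi 0"]) auto
  define c where "c = Sup (range lo)"
  have lo_c: "lo n \<le> c" for n unfolding c_def using bdd by (intro cSup_upper) auto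
  have "c \<le> hi (Suc n)" for n unfolding c_def using lo_hi by (intro cSup_least) auto
  then have c_hi: "c < hi n" for n using hi_step[of n] by (rule le_less_trans)
  have pos: "real p ^ n > 0" for n using p by simp
  show thesis
  proof (rule that)
    fix n
    have "ln (A n) \<le> ?K + c * real p ^ n"
      using lo_c[of n] pos[of n] by (simp add: lo_def L_def pos_divide_le_eq)
    then have "exp (ln (A n)) \<le> exp (?K + c * real p ^ n)" by simp
    then show "A n \<le> exp (?K + c * real p ^ n)" using A[of n] by simp
    have "?K + c * real p ^ n < ln (B n)"
      using c_hi[of n] pos[of n] by (simp add: hi_def L_def pos_less_divide_eq)
    then have "exp (?K + c * real p ^ n) < exp (ln (B n))" by simp
    then show "exp (?K + c * real p ^ n) < B n" using B[of n] by simp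
  qed
qed

lemma add_one_power_gt:
  fixes a :: real
  assumes "a > 0" "k \<ge> 1"
  shows "(a + 1) ^ Suc k > a ^ Suc k + real (Suc k) * a ^ k"
  using assms(2)
proof (induction k rule: nat_induct_at_least)
  case base
  show ?case by (simp add: power2_eq_square algebra_simps)
next
  case (Suc k)
  have "(a ^ Suc k + real (Suc k) * a ^ k) * (a + 1) < (a + 1) ^ Suc k * (a + 1)"
    using Suc.IH assms(1) by (intro mult_strict_right_mono) auto
  moreover have "(a ^ Suc k + real (Suc k) * a ^ k) * (a + 1)
    = a ^ Suc (Suc k) + real (Suc (Suc k)) * a ^ Suc k + real (Suc k) * a ^ k"
    by (simp add: algebra_simps)
  moreover have "real (Suc k) * a ^ k > 0" using assms(1) by simp
  ultimately show ?case by (simp add: mult.commute)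
qed

text \<open>The sandwich is applied from index \<open>1\<close> on, where the class number is \<open>p\<close>.  For \<open>p = 2\<close> both
  step inequalities can be read off from \<open>a\<^sub>n\<^sub>+\<^sub>1 = (a\<^sub>n\<^sup>2 + 3 a\<^sub>n) / 2\<close>.  For odd \<open>p\<close> the upper one
  needs \<open>(a + 1)\<^sup>p > a\<^sup>p + (p\<^sup>2 - 1) a + p\<close>, which follows from the binomial term \<open>p a\<^sup>p\<^sup>-\<^sup>1\<close> as
  \<open>a \<ge> p \<ge> 3\<close>.  The bounds on \<open>\<gamma>\<close> come from the sandwich at index \<open>1\<close>.\<close>

lemma total_classes_gamma:
  assumes p: "p \<ge> 2"
  defines "\<delta> \<equiv> (if p = 2 then 1 else 0 :: real)"
  obtains \<gamma> :: real where "0 < \<gamma>" "\<gamma> < 1"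
    "\<And>n. n \<ge> 1 \<Longrightarrow> total_classes p n + \<delta> \<le> exp (ln (real p) * (1 + \<gamma> * real p ^ n) / (real p - 1))"
    "\<And>n. n \<ge> 1 \<Longrightarrow> exp (ln (real p) * (1 + \<gamma> * real p ^ n) / (real p - 1)) < total_classes p n + \<delta> + 1"
proof -
  let ?T = "\<lambda>n. total_classes p (Suc n)"
  have T_ge: "?T n \<ge> real p" for n using total_classes_ge[OF p] .
  have T_step: "?T (Suc n) = (?T n ^ p + (real p ^ 2 - 1) * ?T n) / real p" for n
    by (rule total_classes.simps(2))
  have T_pos: "?T n > 0" for n using T_ge[of n] p by linarith
  have "\<delta> \<ge> 0" by (simp add: \<delta>_def)
  have lower: "(?T n + \<delta>) ^ p / real p \<le> ?T (Suc n) + \<delta>" for n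
  proof (cases "p = 2")
    case True
    then show ?thesis unfolding T_step using T_pos[of n]
      by (simp add: \<delta>_def power2_eq_square field_simps)
  next
    case False
    have "real p ^ 2 \<ge> 1" using p by simp
    then have "0 \<le> (real p ^ 2 - 1) * ?T n" using T_pos[of n] by (intro mult_nonneg_nonneg) auto
    then have "?T n ^ p / real p \<le> ?T (Suc n)" unfolding T_step by (intro divide_right_mono) auto
    then show ?thesis using False by (simp add: \<delta>_def)
  qed
  have upper: "?T (Suc n) + \<delta> + 1 < (?T n + \<delta> + 1) ^ p / real p" for n
  proof (cases "p = 2")
    case True
    then show ?thesis unfolding T_step using T_pos[of n]
      by (simp add: \<delta>_def power2_eq_square field_simps)
  next
    case False
    then have p3: "p \<ge> 3" using p by simp
    let ?a = "?T n"
    have "?a ^ 2 \<le> ?a ^ (p - 1)"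
      using T_ge[of n] p3 by (intro power_increasing) auto
    moreover have "real p * ?a \<le> ?a ^ 2"
      using T_ge[of n] T_pos[of n] by (simp add: power2_eq_square)
    ultimately have "real p * (real p * ?a) \<le> real p * ?a ^ (p - 1)"
      by (intro mult_left_mono) auto
    moreover have "(?a + 1) ^ p > ?a ^ p + real p * ?a ^ (p - 1)"
      using add_one_power_gt[OF T_pos, of "p - 1" n] p3 by simp
    ultimately have "?a ^ p + (real p ^ 2 - 1) * ?a + real p < (?a + 1) ^ p"
      using T_ge[of n] by (simp add: power2_eq_square algebra_simps)
    then have "(?a ^ p + (real p ^ 2 - 1) * ?a + real p) / real p < (?a + 1) ^ p / real p"
      using p by (intro divide_strict_right_mono) auto
    then show ?thesis unfolding T_step using False p3
      by (simp add: \<delta>_def add_divide_distrib)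
  qed
  obtain c where lo: "\<And>n. ?T n + \<delta> \<le> exp (ln (real p) / (real p - 1) + c * real p ^ n)"
    and hi: "\<And>n. exp (ln (real p) / (real p - 1) + c * real p ^ n) < ?T n + \<delta> + 1"
    using power_recursion_sandwich[of p "\<lambda>n. ?T n + \<delta>" "\<lambda>n. ?T n + \<delta> + 1"]
      p T_pos \<open>\<delta> \<ge> 0\<close> lower upper by (metis add_pos_nonneg less_add_one less_imp_le)
  \<comment> \<open>The sandwich counts from \<open>0\<close> where the class numbers count from \<open>1\<close>, hence the extra factor
    \<open>p\<close> in the denominator.\<close>
  define \<gamma> where "\<gamma> = c * (real p - 1) / (real p * ln (real p))"
  have ln_p: "ln (real p) > 0" using p by simp
  have eq: "ln (real p) / (real p - 1) + c * real p ^ n = ln (real p) * (1 + \<gamma> * real p ^ Suc n) / (real p - 1)" for n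
    using p ln_p by (simp add: \<gamma>_def field_simps)
  have T0: "?T 0 = real p" using total_classes_1[of p] p by simp
  have "0 < c"
  proof (rule ccontr)
    assume "\<not> 0 < c"
    have "real p + \<delta> \<le> exp (ln (real p) / (real p - 1) + c)" using lo[of 0] T0 by simp
    also have "\<dots> \<le> exp (ln (real p) / (real p - 1))" using \<open>\<not> 0 < c\<close> by simp
    finally have le: "real p + \<delta> \<le> exp (ln (real p) / (real p - 1))" .
    show False
    proof (cases "p = 2")
      case True
      then show ?thesis using le by (simp add: \<delta>_def)
    next
      case False
      then have "ln (real p) / (real p - 1) < ln (real p) / 1"
        using p ln_p by (intro divide_strict_left_mono) auto
      then have "exp (ln (real p) / (real p - 1)) < exp (ln (real p))" by simp
      then show ?thesis using le \<open>\<delta> \<ge> 0\<close> p by simp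
    qed
  qed
  then have "0 < \<gamma>" using p ln_p by (simp add: \<gamma>_def)
  have "\<gamma> < 1"
  proof (rule ccontr)
    assume "\<not> \<gamma> < 1"
    then have "ln (real p) * (1 + 1 * real p) / (real p - 1) \<le> ln (real p) * (1 + \<gamma> * real p) / (real p - 1)"
      using p ln_p by (intro divide_right_mono mult_left_mono add_left_mono mult_right_mono) auto
    then have "exp (ln (real p) * (1 + real p) / (real p - 1))
        \<le> exp (ln (real p) * (1 + \<gamma> * real p) / (real p - 1))" by simp
    also have "\<dots> < real p + \<delta> + 1"
      using hi[of 0] T0 eq[of 0] by simp
    finally have "exp (ln (real p) * (1 + real p) / (real p - 1)) < real p + \<delta> + 1" .
    moreover have "ln (real p) * (1 + real p) / (real p - 1) = ln (real p) + 2 * ln (real p) / (real p - 1)"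
      using p by (simp add: field_simps)
    ultimately have *: "real p * exp (2 * ln (real p) / (real p - 1)) < real p + \<delta> + 1"
      using p by (simp add: exp_add)
    show False
    proof (cases "p = 2")
      case True
      have "exp (2 * ln (2::real)) = 4" by (simp add: exp_double)
      then show ?thesis using * True by (simp add: \<delta>_def)
    next
      case False
      have "real p * (1 + 2 * ln (real p) / (real p - 1)) \<le> real p * exp (2 * ln (real p) / (real p - 1))"
        by (intro mult_left_mono exp_ge_add_one_self) auto
      then have "real p * (2 * ln (real p) / (real p - 1)) < 1"
        using * False by (simp add: \<delta>_def distrib_left)
      moreover have "2 * ln (real p) \<le> real p * (2 * ln (real p) / (real p - 1))"
        using p ln_p by (simp add: field_simps)
      moreover have "ln (real p) \<ge> ln 2" using p by simp
      moreover have "ln 2 \<ge> (1/2 :: real)" using ln_le_minus_one[of "1/2 :: real"] by (simp add: ln_div)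
      ultimately show ?thesis by linarith
    qed
  qed
  show thesis
  proof (rule that[OF \<open>0 < \<gamma>\<close> \<open>\<gamma> < 1\<close>])
    fix n :: nat assume "n \<ge> 1"
    then obtain m where n: "n = Suc m" by (cases n) auto
    show "total_classes p n + \<delta> \<le> exp (ln (real p) * (1 + \<gamma> * real p ^ n) / (real p - 1))"
      using lo[of m] by (simp only: n eq)
    show "exp (ln (real p) * (1 + \<gamma> * real p ^ n) / (real p - 1)) < total_classes p n + \<delta> + 1"
      using hi[of m] by (simp only: n eq)
  qed
qed

section \<open>Class numbers of the Sylow subgroups\<close>

locale sylow_of_sym_group =
  fixes p n :: nat and H :: "(nat \<Rightarrow> nat) set"
  assumes prime: "Factorial_Ring.prime p" and sylow: "is_sylow_subgroup p (sym_group (p ^ n)) H"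
begin

abbreviation G where "G \<equiv> (sym_group (p ^ n))\<lparr>carrier := H\<rparr>"

lemma order_G: "order G = p ^ sylow_exponent p n"
  using sylow by (simp add: is_sylow_subgroup_sym_group_iff prime order_def)

sublocale group G
  using sylow by (intro group.subgroup_imp_group sym_group_is_group)
    (simp add: is_sylow_subgroup_sym_group_iff prime)

lemma finite_G: "finite (carrier G)"
  using order_gt_0_iff_finite order_G prime_gt_0_nat[OF prime] by simp

sublocale prime_wreath G p
  by unfold_locales (rule finite_G prime)+

end

lemma sylow_torsion_class_count_step:
  assumes "Factorial_Ring.prime p"
    and H: "is_sylow_subgroup p (sym_group (p ^ n)) H"
    and K: "is_sylow_subgroup p (sym_group (p ^ Suc n)) K"
  shows "p * torsion_class_count ((sym_group (p ^ Suc n))\<lparr>carrier := K\<rparr>) (p * r) =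
    torsion_class_count ((sym_group (p ^ n))\<lparr>carrier := H\<rparr>) (p * r) ^ p
    + (p - 1) * torsion_class_count ((sym_group (p ^ n))\<lparr>carrier := H\<rparr>) (p * r)
    + (p - 1) * p * torsion_class_count ((sym_group (p ^ n))\<lparr>carrier := H\<rparr>) r"
proof -
  interpret H: sylow_of_sym_group p n H using assms by unfold_locales
  interpret K: sylow_of_sym_group p "Suc n" K using assms by unfold_locales
  obtain h where h: "h \<in> iso H.W K.G" using sylow_sym_group_iso_wreath[OF assms] .
  have "torsion_class_count K.G (p * r) = torsion_class_count H.W (p * r)"
    using torsion_class_count_iso[OF H.group_wreath K.is_group h H.finite_wreath] by simp
  then show ?thesis using H.torsion_class_count_wreath[of r] by simp
qed

lemma sylow_exponent_step:
  assumes "Factorial_Ring.prime p"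
    and H: "is_sylow_subgroup p (sym_group (p ^ n)) H"
    and K: "is_sylow_subgroup p (sym_group (p ^ Suc n)) K"
    and exp: "\<And>u. u \<in> H \<Longrightarrow> u [^]\<^bsub>(sym_group (p ^ n))\<lparr>carrier := H\<rparr>\<^esub> r = \<one>\<^bsub>sym_group (p ^ n)\<^esub>"
    and x: "x \<in> K"
  shows "x [^]\<^bsub>(sym_group (p ^ Suc n))\<lparr>carrier := K\<rparr>\<^esub> (p * r) = \<one>\<^bsub>sym_group (p ^ Suc n)\<^esub>"
proof -
  interpret H: sylow_of_sym_group p n H using assms by unfold_locales
  interpret K: sylow_of_sym_group p "Suc n" K using assms by unfold_locales
  obtain h where h: "h \<in> iso H.W K.G" using sylow_sym_group_iso_wreath[OF assms(1-3)] .
  interpret h: group_hom H.W K.G h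
    using h by unfold_locales (simp add: iso_def)
  obtain t where t: "t \<in> carrier H.W" "x = h t"
    using h x by (auto simp: iso_def bij_betw_def)
  have "t [^]\<^bsub>H.W\<^esub> (p * r) = \<one>\<^bsub>H.W\<^esub>" using H.wreath_pow_eq_one[of r t] exp t by simp
  then have "x [^]\<^bsub>K.G\<^esub> (p * r) = \<one>\<^bsub>K.G\<^esub>" using t h.hom_nat_pow[of t "p * r"] h.hom_one by metis
  then show ?thesis by simp
qed

text \<open>The Sylow property is required at \<open>n = 0\<close> as well, so that inductions can start from the trivial
  group.\<close>

lemma num_classes_sylow:
  fixes P :: "nat \<Rightarrow> (nat \<Rightarrow> nat) set"
  assumes p: "Factorial_Ring.prime p" and sylow: "\<And>n. is_sylow_subgroup p (sym_group (p ^ n)) (P n)"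
  shows "num_classes p P n k = torsion_class_count (sylow_group p P n) (p ^ k)"
proof -
  interpret sylow_of_sym_group p n "P n" using p sylow by unfold_locales
  have "x \<in> carrier G" if "C \<in> conjugacy_classes G" "x \<in> C" for C x
    using that Union_conjugacy_classes by blast
  then show ?thesis
    unfolding num_classes_def torsion_class_count_def sylow_group_def
    using ord_le_prime_power_iff[OF p order_G]
    by (intro arg_cong[where f = card]) blast
qed

text \<open>Every element of \<open>P n\<close> is killed by \<open>p ^ n\<close>, so the counts for \<open>p ^ n\<close> and for \<open>p ^ Suc n\<close> agree
  on \<open>P n\<close>, and the two-parameter recurrence closes up on the totals.\<close>

lemma sylow_total_classes:
  fixes P :: "nat \<Rightarrow> (nat \<Rightarrow> nat) set"
  assumes p: "Factorial_Ring.prime p" and sylow: "\<And>n. is_sylow_subgroup p (sym_group (p ^ n)) (P n)"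
  shows "torsion_class_count (sylow_group p P n) (p ^ n) = card (conjugacy_classes (sylow_group p P n))"
    and "real (torsion_class_count (sylow_group p P n) (p ^ n)) = total_classes p n"
proof -
  have exp: "x [^]\<^bsub>sylow_group p P n\<^esub> (p ^ n) = \<one>\<^bsub>sym_group (p ^ n)\<^esub>" if "x \<in> P n" for n x
    using that
  proof (induction n arbitrary: x)
    case 0
    interpret sylow_of_sym_group p 0 "P 0" using p sylow[of 0] by unfold_locales
    have "P 0 \<subseteq> carrier (sym_group (p ^ 0))"
      using assms(2)[of 0] by (simp add: is_sylow_subgroup_def subgroup.subset)
    then have "x = id" using 0 by (auto simp: sym_group_def)
    moreover have "x \<in> carrier G" using 0 by simp
    then have "x [^]\<^bsub>G\<^esub> (p ^ 0) = x" by (rule nat_pow_eone[folded power_0[of p]])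
    ultimately show ?case unfolding sylow_group_def sym_group_one by (simp only:)
  next
    case (Suc n)
    then show ?case using sylow_exponent_step[OF p sylow sylow, of n "p ^ n" x]
      by (simp add: sylow_group_def)
  qed
  have higher: "torsion_class_count (sylow_group p P n) (p ^ k) = card (conjugacy_classes (sylow_group p P n))"
    if "n \<le> k" for n k
  proof -
    interpret sylow_of_sym_group p n "P n" using p sylow by unfold_locales
    have "x [^]\<^bsub>G\<^esub> (p ^ k) = \<one>\<^bsub>G\<^esub>" if "x \<in> carrier G" for x
    proof -
      have "x [^]\<^bsub>G\<^esub> (p ^ n) = \<one>\<^bsub>G\<^esub>"
        using exp[of x n] that by (simp add: sylow_group_def)
      then have "(x [^]\<^bsub>G\<^esub> (p ^ n)) [^]\<^bsub>G\<^esub> (p ^ (k - n)) = \<one>\<^bsub>G\<^esub>"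
        by (simp only: nat_pow_one)
      then show ?thesis using that \<open>n \<le> k\<close> by (simp add: nat_pow_pow flip: power_add)
    qed
    then show ?thesis unfolding sylow_group_def by (rule torsion_class_count_exponent)
  qed
  show "torsion_class_count (sylow_group p P n) (p ^ n) = card (conjugacy_classes (sylow_group p P n))"
    by (rule higher) simp
  show "real (torsion_class_count (sylow_group p P n) (p ^ n)) = total_classes p n"
  proof (induction n)
    case 0
    interpret sylow_of_sym_group p 0 "P 0" using p sylow[of 0] by unfold_locales
    have "card (P 0) = 1" using order_G by (simp add: order_def sylow_exponent_def)
    then obtain x where "carrier G = {x}" by (auto simp: card_1_singleton_iff)
    then have "conjugacy_classes G = {{x}}" using m_closed inv_closed
      by (auto simp: conjugacy_classes_def orbits_def orbit_def)
    then show ?case using higher[of 0 0] by (simp add: sylow_group_def)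
  next
    case (Suc n)
    have p0: "p > 0" using p by (rule prime_gt_0_nat)
    then have p1: "real (p - 1) = real p - 1" by (simp add: of_nat_diff)
    let ?h = "torsion_class_count (sylow_group p P n) (p ^ n)"
    have "torsion_class_count (sylow_group p P n) (p ^ Suc n) = ?h"
      using higher[of n n] higher[of n "Suc n"] by simp
    then have "p * torsion_class_count (sylow_group p P (Suc n)) (p ^ Suc n) =
      ?h ^ p + (p - 1) * ?h + (p - 1) * p * ?h"
      using sylow_torsion_class_count_step[OF p sylow sylow, of n "p ^ n"] by (simp add: sylow_group_def)
    then have "real p * real (torsion_class_count (sylow_group p P (Suc n)) (p ^ Suc n)) =
      real ?h ^ p + (real p - 1) * real ?h + (real p - 1) * real p * real ?h"
      by (simp only: of_nat_eq_iff[where 'a = real, symmetric] of_nat_mult of_nat_add of_nat_power p1)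
    then show ?case using p0 Suc by (simp add: total_classes.simps(2) field_simps power2_eq_square)
  qed
qed

theorem theorem2:
  fixes p :: nat
  assumes "Factorial_Ring.prime p"
  shows "(\<forall>P. sylow_family p P \<longrightarrow>
            (\<forall>n\<ge>1. \<forall>k\<ge>1.
               real (num_classes p P (n + 1) k) =
                 1 / real p * (real (num_classes p P n k) ^ p - real (num_classes p P n k))
                   + real (num_classes p P n k) + (real p - 1) * real (num_classes p P n (k - 1))))
       \<and> (\<exists>\<gamma>::real. 0 < \<gamma> \<and> \<gamma> < 1 \<and>
            (\<forall>P. sylow_family p P \<longrightarrow>
               (\<forall>n\<ge>1.
                  num_classes p P n n = card (conjugacy_classes (sylow_group p P n)) \<and>
                  int (num_classes p P n n) =
                    \<lfloor>real p powr ((\<gamma> + 1) / (real p - 1))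
                       * real (order (sylow_group p P n)) powr \<gamma>\<rfloor>
                    - (if p = 2 then 1 else 0))))"
proof (intro conjI)
  have p2: "p \<ge> 2" and p0: "p > 0" using assms prime_ge_2_nat prime_gt_0_nat by auto
  then have p1: "real (p - 1) = real p - 1" by (simp add: of_nat_diff)
  \<comment> \<open>A Sylow family is arbitrary at index \<open>0\<close>, but the inductions start there.\<close>
  define extend where "extend P = P(0 := {id})" for P :: "nat \<Rightarrow> (nat \<Rightarrow> nat) set"
  have ext_sylow: "is_sylow_subgroup p (sym_group (p ^ n)) (extend P n)" if "sylow_family p P" for P n
  proof (cases n)
    case 0
    have "subgroup {id} (sym_group (p ^ 0))"
      using group.triv_subgroup[OF sym_group_is_group, of "p ^ 0"] by (simp add: sym_group_one)
    then show ?thesis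
      using 0 assms is_sylow_subgroup_sym_group_iff[of p 0 "{id}"]
      by (simp add: extend_def sylow_exponent_def)
  next
    case (Suc m)
    then show ?thesis using that by (simp add: extend_def sylow_family_def del: power_Suc)
  qed
  have ext: "sylow_group p P n = sylow_group p (extend P) n"
    "num_classes p P n k = num_classes p (extend P) n k" if "n \<ge> 1" for P n k
    using that by (simp_all add: extend_def sylow_group_def num_classes_def)
  show "\<forall>P. sylow_family p P \<longrightarrow> (\<forall>n\<ge>1. \<forall>k\<ge>1.
               real (num_classes p P (n + 1) k) =
                 1 / real p * (real (num_classes p P n k) ^ p - real (num_classes p P n k))
                   + real (num_classes p P n k) + (real p - 1) * real (num_classes p P n (k - 1)))"
  proof (intro allI impI)
    fix P n k assume P: "sylow_family p P" and n: "(n::nat) \<ge> 1" and k: "(k::nat) \<ge> 1"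
    let ?h = "num_classes p P"
    have *: "?h m j = torsion_class_count ((sym_group (p ^ m))\<lparr>carrier := extend P m\<rparr>) (p ^ j)"
      if "m \<ge> 1" for m j
      using num_classes_sylow[OF assms ext_sylow[OF P]]
      by (simp add: ext(2)[OF that, of P j] sylow_group_def)
    have "p * p ^ (k - 1) = p ^ k" using k by (cases k) auto
    then have "p * ?h (n + 1) k = ?h n k ^ p + (p - 1) * ?h n k + (p - 1) * p * ?h n (k - 1)"
      using sylow_torsion_class_count_step[OF assms ext_sylow[OF P] ext_sylow[OF P], of n "p ^ (k - 1)"] n
      by (simp add: *)
    then have "real p * real (?h (n + 1) k) = real (?h n k) ^ p + (real p - 1) * real (?h n k)
        + (real p - 1) * real p * real (?h n (k - 1))"
      by (simp only: of_nat_eq_iff[where 'a = real, symmetric] of_nat_mult of_nat_add of_nat_power p1)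
    then show "real (?h (n + 1) k) = 1 / real p * (real (?h n k) ^ p - real (?h n k))
        + real (?h n k) + (real p - 1) * real (?h n (k - 1))"
      using p0 by (simp add: field_simps)
  qed
  obtain \<gamma> :: real where \<gamma>: "0 < \<gamma>" "\<gamma> < 1"
    and lo: "\<And>n. n \<ge> 1 \<Longrightarrow> total_classes p n + (if p = 2 then 1 else 0)
      \<le> exp (ln (real p) * (1 + \<gamma> * real p ^ n) / (real p - 1))"
    and hi: "\<And>n. n \<ge> 1 \<Longrightarrow> exp (ln (real p) * (1 + \<gamma> * real p ^ n) / (real p - 1))
      < total_classes p n + (if p = 2 then 1 else 0) + 1"
    using total_classes_gamma[OF p2] by blast
  show "\<exists>\<gamma>::real. 0 < \<gamma> \<and> \<gamma> < 1 \<and>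
            (\<forall>P. sylow_family p P \<longrightarrow>
               (\<forall>n\<ge>1.
                  num_classes p P n n = card (conjugacy_classes (sylow_group p P n)) \<and>
                  int (num_classes p P n n) =
                    \<lfloor>real p powr ((\<gamma> + 1) / (real p - 1))
                       * real (order (sylow_group p P n)) powr \<gamma>\<rfloor>
                    - (if p = 2 then 1 else 0)))"
  proof (intro exI[of _ \<gamma>] conjI \<gamma> allI impI)
    fix P n assume P: "sylow_family p P" and n: "(n::nat) \<ge> 1"
    note total = sylow_total_classes[OF assms ext_sylow[OF P], of n]
    have count: "num_classes p P n n = torsion_class_count (sylow_group p (extend P) n) (p ^ n)"
      using ext(2)[OF n, of P n] num_classes_sylow[OF assms ext_sylow[OF P]] by simp
    show "num_classes p P n n = card (conjugacy_classes (sylow_group p P n))"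
      using count total(1) ext(1)[OF n, of P] by simp
    have "order (sylow_group p P n) = p ^ sylow_exponent p n"
      using P n is_sylow_subgroup_sym_group_iff[OF assms]
      by (simp add: sylow_family_def sylow_group_def order_def)
    then have "real (order (sylow_group p P n)) powr \<gamma> = exp (ln (real p) * (\<gamma> * real (sylow_exponent p n)))"
      using p0 by (simp add: powr_def ln_realpow)
    then have "real p powr ((\<gamma> + 1) / (real p - 1)) * real (order (sylow_group p P n)) powr \<gamma>
      = exp (ln (real p) * ((\<gamma> + 1) / (real p - 1)) + ln (real p) * (\<gamma> * real (sylow_exponent p n)))"
      using p0 by (simp add: powr_def exp_add mult.commute)
    also have "ln (real p) * ((\<gamma> + 1) / (real p - 1)) + ln (real p) * (\<gamma> * real (sylow_exponent p n))
      = ln (real p) * (1 + \<gamma> * real p ^ n) / (real p - 1)"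
      by (simp add: real_sylow_exponent[OF p2] algebra_simps flip: add_divide_distrib)
    finally have "\<lfloor>real p powr ((\<gamma> + 1) / (real p - 1)) * real (order (sylow_group p P n)) powr \<gamma>\<rfloor>
      = int (num_classes p P n n) + (if p = 2 then 1 else 0)"
      using lo[OF n] hi[OF n] total(2) count by (simp add: floor_eq_iff split: if_splits)
    then show "int (num_classes p P n n) =
      \<lfloor>real p powr ((\<gamma> + 1) / (real p - 1)) * real (order (sylow_group p P n)) powr \<gamma>\<rfloor>
      - (if p = 2 then 1 else 0)" by simp
  qed
qed

end
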